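(* Let $\{S^{(t)}\}_{t\ge1}$ be i.i.d. almost surely invertible random $n\times n$ real matrices with common distribution $p_S$. Define the Markov chain on $\mathsf P_n$ by $\mathbf X_t=S^{(t)}\cdots S^{(1)}\mathbf X_0$. Assume the following conditions. - (L1) No proper linear subspace $V\subseteq\mathbb{R}^n$ satisfies $S^{(1)}V\subseteq V$ almost surely. - (L2) Some sequence of matrices in the support of $p_S$ has products $S^T=S^{(T)}\cdots S^{(1)}$ with $\sigma_2(S^T)/\sigma_1(S^T)\to0$ as $T\to\infty$. - (A1) There is a measurable set $\mathsf G\subseteq\mathsf P_n$ with $S^{(t)}\mathbf x\in\mathsf G$ almost surely for every $\mathbf x\in\mathsf G$. - (A2') There are constants $\rho\in(0,1)$ and $\lambda>0$ such that for all $\mathbf x\ne\mathbf y\in\mathsf G$, $\mathbb{E}[d(S^{(t)}\mathbf x,S^{(t)}\mathbf y)^\lambda]\le\rho\,d(\mathbf x,\mathbf y)^\lambda$. Let $\mu$ be the unique stationary probability measure of the chain, and let $\mathbf X_0=\mathbf x_0\in\mathsf G$. Then for every $\lambda$-Hölder function $f:\mathsf P_n\to\mathbb{R}$ and every $t\ge0$, $$|\mathbb{E}\{f(\mathbf X_t)\}-\mu(f)|\le\rho^t[f]_\lambda.$$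
   Context: $\mathsf P_n$ is the projective space of lines through the origin in $\mathbb{R}^n$ (unit vectors modulo sign). Its metric is $d(\mathbf x,\mathbf y)=\sqrt{1-\langle x,y\rangle^2}$ for unit representatives $x,y$. An invertible $S$ acts on $\mathsf P_n$ by sending the class of $x$ to the class of $Sx/\|Sx\|$. $\sigma_1,\sigma_2$ are the two largest singular values. The Hölder coefficient is $[f]_\lambda=\sup_{\mathbf x\ne\mathbf y}|f(\mathbf x)-f(\mathbf y)|/d(\mathbf x,\mathbf y)^\lambda$, and $f$ is $\lambda$-Hölder if $[f]_\lambda<\infty$. $\mu(f)=\int f\,d\mu$. Under (L1) and (L2) the chain is known to have a unique stationary probability measure. *)

theory Defs
  imports "HOL-Probability.Probability"
begin

text \<open>Points of the projective space P_n are represented by unit vectors of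
  real^'n; x and -x represent the same point.  Functions on P_n are represented
  by functions on real^'n that are even on the unit sphere, subsets of P_n by
  sign-symmetric subsets of the unit sphere.\<close>

definition proj_dist :: "real^'n \<Rightarrow> real^'n \<Rightarrow> real" where
  "proj_dist x y = sqrt (1 - (x \<bullet> y)^2)"

definition pact :: "real^'n^'n \<Rightarrow> real^'n \<Rightarrow> real^'n" where
  "pact S x = (S *v x) /\<^sub>R norm (S *v x)"

fun mprod :: "nat \<Rightarrow> (nat \<Rightarrow> real^'n^'n) \<Rightarrow> real^'n^'n" where
  "mprod 0 w = mat 1"
| "mprod (Suc t) w = w t ** mprod t w"

text \<open>k-th largest singular value (max-min characterisation); 0 if k exceeds n.\<close>
definition sing_val :: "nat \<Rightarrow> real^'n^'n \<Rightarrow> real" where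
  "sing_val k A = (if 1 \<le> k \<and> k \<le> CARD('n) then
      Sup {Inf {norm (A *v x) | x. x \<in> V \<and> norm x = 1} | V. subspace V \<and> dim V = k}
    else 0)"

definition msupport :: "'a::topological_space measure \<Rightarrow> 'a set" where
  "msupport M = {a. \<forall>U. open U \<longrightarrow> a \<in> U \<longrightarrow> emeasure M U > 0}"

definition proj_fun :: "(real^'n \<Rightarrow> real) \<Rightarrow> bool" where
  "proj_fun f \<longleftrightarrow> (\<forall>x. norm x = 1 \<longrightarrow> f (-x) = f x)"

definition holder_set :: "real \<Rightarrow> (real^'n \<Rightarrow> real) \<Rightarrow> real set" where
  "holder_set l f = {\<bar>f x - f y\<bar> / proj_dist x y powr l | x y.
      norm x = 1 \<and> norm y = 1 \<and> x \<noteq> y \<and> x \<noteq> -y}"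

definition is_holder :: "real \<Rightarrow> (real^'n \<Rightarrow> real) \<Rightarrow> bool" where
  "is_holder l f \<longleftrightarrow> bdd_above (holder_set l f)"

definition holder_coeff :: "real \<Rightarrow> (real^'n \<Rightarrow> real) \<Rightarrow> real" where
  "holder_coeff l f = Sup (insert 0 (holder_set l f))"

text \<open>Measures on P_n, represented as probability measures on the unit sphere.\<close>
definition sphere_space :: "(real^'n) measure" where
  "sphere_space = restrict_space borel (sphere 0 1)"

definition stationary :: "(real^'n^'n) measure \<Rightarrow> (real^'n) measure \<Rightarrow> bool" where
  "stationary pS mu \<longleftrightarrow>
     (\<forall>A \<in> sets sphere_space. uminus ` A = A \<longrightarrow>
        emeasure mu A = (\<integral>\<^sup>+ x. emeasure pS {S \<in> space pS. pact S x \<in> A} \<partial>mu))"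

end

theory Submission
  imports Defs
begin

text \<open>Replacing the set \<open>G\<close> by its closure preserves invariance and contraction, so let \<open>G\<close> be closed.
  If a stationary measure \<open>\<mu>\<close> is carried by \<open>G\<close>, the bound follows by integrating the
  \<open>t\<close>-step contraction estimate between \<open>x\<^sub>0\<close> and a \<open>\<mu>\<close>-distributed point.

  To see that \<open>\<mu>\<close> is carried by \<open>G\<close>, note that \<open>G\<close> spans the whole space by irreducibility and
  contains a basis. Long products \<open>M\<close> bring the images of this basis together, so limits of
  \<open>M / \<parallel>M\<parallel>\<close> have rank one with image in \<open>G\<close>, and \<open>M x\<close> can stay away from \<open>G\<close> only if \<open>x\<close> is close to a
  hyperplane. By stationarity the part of \<open>\<mu>\<close> outside \<open>G\<close> never moves into \<open>G\<close>, hence it lives on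
  one hyperplane; the smallest subspace carrying it is almost surely invariant, contradicting
  irreducibility.\<close>

section \<open>The projective action and its metric\<close>

lemma continuous_on_matrix_vector_mult [continuous_intros]:
  fixes f :: "'a::topological_space \<Rightarrow> real^'n^'m"
  assumes "continuous_on A f" "continuous_on A g"
  shows "continuous_on A (\<lambda>x. f x *v g x)"
  unfolding matrix_vector_mult_def
  by (intro continuous_intros assms)

lemma continuous_on_matrix_matrix_mult [continuous_intros]:
  fixes f :: "'a::topological_space \<Rightarrow> real^'n^'m" and g :: "'a \<Rightarrow> real^'k^'n"
  assumes "continuous_on A f" "continuous_on A g"
  shows "continuous_on A (\<lambda>x. f x ** g x)"
  unfolding matrix_matrix_mult_def
  by (intro continuous_intros assms)

lemma borel_measurable_matrix_vector_mult [measurable]: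
  fixes f :: "'a \<Rightarrow> real^'n^'m"
  assumes "f \<in> borel_measurable M" "g \<in> borel_measurable M"
  shows "(\<lambda>x. f x *v g x) \<in> borel_measurable M"
  by (rule borel_measurable_continuous_Pair[OF assms]) (intro continuous_intros)

lemma borel_measurable_matrix_matrix_mult [measurable]:
  fixes f :: "'a \<Rightarrow> real^'n^'m" and g :: "'a \<Rightarrow> real^'k^'n"
  assumes "f \<in> borel_measurable M" "g \<in> borel_measurable M"
  shows "(\<lambda>x. f x ** g x) \<in> borel_measurable M"
  by (rule borel_measurable_continuous_Pair[OF assms]) (intro continuous_intros)

lemma borel_measurable_pact [measurable]:
  fixes f :: "'a \<Rightarrow> real^'n^'n"
  assumes [measurable]: "f \<in> borel_measurable M" "g \<in> borel_measurable M"
  shows "(\<lambda>x. pact (f x) (g x)) \<in> borel_measurable M"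
  unfolding pact_def by measurable

lemma borel_measurable_proj_dist [measurable]:
  fixes f :: "'a \<Rightarrow> real^'n"
  assumes [measurable]: "f \<in> borel_measurable M" "g \<in> borel_measurable M"
  shows "(\<lambda>x. proj_dist (f x) (g x)) \<in> borel_measurable M"
  unfolding proj_dist_def by measurable

lemma tendsto_proj_dist:
  assumes "(f \<longlongrightarrow> a) F" "(g \<longlongrightarrow> b) F"
  shows "((\<lambda>x. proj_dist (f x) (g x)) \<longlongrightarrow> proj_dist a b) F"
  unfolding proj_dist_def by (intro tendsto_intros assms)

lemma tendsto_matrix_vector_mult:
  fixes f :: "'a \<Rightarrow> real^'n^'m"
  assumes "(f \<longlongrightarrow> A) F" "(g \<longlongrightarrow> y) F"
  shows "((\<lambda>x. f x *v g x) \<longlongrightarrow> A *v y) F"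
  unfolding matrix_vector_mult_def by (intro tendsto_intros assms)

lemma tendsto_pact:
  assumes "(f \<longlongrightarrow> A) F" "(g \<longlongrightarrow> y) F" "A *v y \<noteq> 0"
  shows "((\<lambda>x. pact (f x) (g x)) \<longlongrightarrow> pact A y) F"
  unfolding pact_def
  by (intro tendsto_intros tendsto_matrix_vector_mult assms) (use assms in auto)

lemma pact_mat_1: "norm x = 1 \<Longrightarrow> pact (mat 1) x = x"
  by (simp add: pact_def)

lemma pact_zero [simp]: "pact S 0 = 0"
  by (simp add: pact_def)

lemma pact_uminus [simp]: "pact S (- x) = - pact S x"
  by (simp add: pact_def linear_neg[OF matrix_vector_mul_linear])

text \<open>The positive factor that normalises \<open>pact M x\<close> cancels in the outer
  normalisation; if \<open>M *v x = 0\<close>, both sides take the default value 0. The identity is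
  therefore free of almost-sure clauses.\<close>

lemma pact_matrix_mult: "pact (S ** M) x = pact S (pact M x)"
proof (cases "M *v x = 0")
  case True
  then show ?thesis
    by (simp add: pact_def flip: matrix_vector_mul_assoc)
next
  case False
  then show ?thesis
    by (simp add: pact_def matrix_vector_mult_scaleR flip: matrix_vector_mul_assoc)
qed

lemma pact_scaleR: "0 < c \<Longrightarrow> pact (c *\<^sub>R S) x = pact S x"
  by (simp add: pact_def flip: scaleR_matrix_vector_assoc)

lemma norm_pact: "S *v x \<noteq> 0 \<Longrightarrow> norm (pact S x) = 1"
  by (simp add: pact_def)

lemma norm_pact_eq_1_iff: "norm (pact S x) = 1 \<longleftrightarrow> S *v x \<noteq> 0"
  by (auto simp: pact_def)

text \<open>The default value 0 of \<open>pact\<close> lies in the unit ball, so this bound holds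
  for every matrix. It supplies pointwise domination without discarding null sets, which is why the
  distance bounds are stated on the ball.\<close>

lemma norm_pact_le: "norm (pact S x) \<le> 1"
  by (cases "S *v x = 0") (auto simp: pact_def)

lemma invertible_mult_vector_neq_0:
  fixes S :: "real^'n^'n"
  assumes "invertible S" "x \<noteq> 0"
  shows "S *v x \<noteq> 0"
  using assms by (metis invertible_def matrix_left_invertible_ker)

lemma proj_dist_bounds:
  assumes "norm x \<le> 1" "norm y \<le> 1"
  shows "0 \<le> proj_dist x y" "proj_dist x y \<le> 1"
proof -
  have "\<bar>x \<bullet> y\<bar> \<le> norm x * norm y"
    by (rule Cauchy_Schwarz_ineq2)
  also have "\<dots> \<le> 1"
    using assms by (simp add: mult_le_one)
  finally have "(x \<bullet> y)\<^sup>2 \<le> 1"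
    by (simp add: abs_square_le_1)
  then show "0 \<le> proj_dist x y" "proj_dist x y \<le> 1"
    by (auto simp: proj_dist_def)
qed

lemma proj_dist_powr_bounds:
  assumes "norm x \<le> 1" "norm y \<le> 1" "0 < l"
  shows "0 \<le> proj_dist x y powr l" "proj_dist x y powr l \<le> 1"
  using proj_dist_bounds[OF assms(1,2)] assms(3) by (auto intro: powr_le1)

lemma proj_dist_eq_0_iff:
  assumes "norm x = 1" "norm y = 1"
  shows "proj_dist x y = 0 \<longleftrightarrow> x = y \<or> x = - y"
proof -
  have "proj_dist x y = 0 \<longleftrightarrow> \<bar>x \<bullet> y\<bar> = 1"
    unfolding proj_dist_def by (auto simp: power2_eq_1_iff abs_if)
  also have "\<dots> \<longleftrightarrow> x = y \<or> x = - y"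
    using norm_cauchy_schwarz_abs_eq[of x y] assms by (auto simp: minus_equation_iff)
  finally show ?thesis .
qed

text \<open>The limit distance may be 0, where convergence of \<open>powr\<close> requires
  nonnegative bases; the norm bounds on \<open>f\<close> and \<open>g\<close> provide this.\<close>

lemma tendsto_proj_dist_powr:
  fixes a b :: "real^'n"
  assumes "(f \<longlongrightarrow> a) F" "(g \<longlongrightarrow> b) F" "norm a = 1" "norm b = 1" "0 < l"
    and "\<And>x. norm (f x) \<le> 1" "\<And>x. norm (g x) \<le> 1"
  shows "((\<lambda>x. proj_dist (f x) (g x) powr l) \<longlongrightarrow> proj_dist a b powr l) F"
  by (rule tendsto_powr'[OF tendsto_proj_dist tendsto_const])
     (use assms in \<open>auto intro!: always_eventually proj_dist_bounds(1)\<close>)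

section \<open>Hoelder functions on projective space\<close>

lemma holder_coeff_nonneg: "is_holder l f \<Longrightarrow> 0 \<le> holder_coeff l f"
  unfolding holder_coeff_def is_holder_def by (rule cSup_upper) auto

text \<open>For pairs excluded from \<open>holder_set\<close>, evenness of \<open>f\<close> makes
  the left side vanish; all others are bounded by the supremum.\<close>

lemma holder_coeff_bound:
  assumes f: "proj_fun f" "is_holder l f" and xy: "norm x = 1" "norm y = 1"
  shows "\<bar>f x - f y\<bar> \<le> holder_coeff l f * proj_dist x y powr l"
proof (cases "x = y \<or> x = - y")
  case True
  then have "f x = f y"
    using f xy by (auto simp: proj_fun_def)
  then show ?thesis
    using holder_coeff_nonneg[OF f(2)] by simp
next
  case False
  then have "\<bar>f x - f y\<bar> / proj_dist x y powr l \<in> holder_set l f"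
    using xy by (auto simp: holder_set_def)
  then have "\<bar>f x - f y\<bar> / proj_dist x y powr l \<le> holder_coeff l f"
    unfolding holder_coeff_def using f(2) by (intro cSup_upper) (auto simp: is_holder_def)
  moreover have "proj_dist x y > 0"
    using False xy proj_dist_bounds(1)[of x y] proj_dist_eq_0_iff[of x y] by simp
  ultimately show ?thesis
    by (simp add: field_simps)
qed

text \<open>The distance to \<open>x\<close>, raised to the power \<open>l\<close>, tends to 0 at
  \<open>x\<close> and dominates the increments of \<open>f\<close>. Borel measurability of the test
  function will come from this continuity.\<close>

lemma holder_imp_continuous_on_sphere:
  fixes f :: "real^'n \<Rightarrow> real"
  assumes f: "proj_fun f" "is_holder l f" and l: "0 < l"
  shows "continuous_on (sphere 0 1) f"
  unfolding continuous_on_def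
proof
  fix x :: "real^'n"
  assume "x \<in> sphere 0 1"
  then have x: "norm x = 1" by simp
  have "((\<lambda>y. proj_dist x y powr l) \<longlongrightarrow> proj_dist x x powr l) (at x within sphere 0 1)"
  proof (rule tendsto_powr'[OF _ tendsto_const])
    show "(proj_dist x \<longlongrightarrow> proj_dist x x) (at x within sphere 0 1)"
      by (rule tendsto_proj_dist) (rule tendsto_const tendsto_ident_at)+
    show "proj_dist x x \<noteq> 0 \<or>
        0 < l \<and> (\<forall>\<^sub>F y in at x within sphere 0 1. 0 \<le> proj_dist x y)"
      using x l by (auto simp: eventually_at_filter proj_dist_bounds(1))
  qed
  then have "((\<lambda>y. holder_coeff l f * proj_dist x y powr l) \<longlongrightarrow> holder_coeff l f * proj_dist x x powr l)
      (at x within sphere 0 1)"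
    by (rule tendsto_mult_left)
  then have "((\<lambda>y. holder_coeff l f * proj_dist x y powr l) \<longlongrightarrow> 0) (at x within sphere 0 1)"
    using proj_dist_eq_0_iff[of x x] x by simp
  then have "((\<lambda>y. f y - f x) \<longlongrightarrow> 0) (at x within sphere 0 1)"
    by (rule Lim_null_comparison[rotated])
       (use holder_coeff_bound[OF f x] in \<open>auto simp: eventually_at_filter abs_minus_commute\<close>)
  then show "(f \<longlongrightarrow> f x) (at x within sphere 0 1)"
    using LIM_zero_iff by blast
qed

section \<open>Random matrix products and stationarity\<close>

text \<open>Stationarity only speaks about sign-symmetric sets, so it is an equality of measures on the
  sigma-algebra of these sets; a function is measurable for the latter iff it is Borel and even.\<close>

definition even_borel :: "'a::real_normed_vector measure" where
  "even_borel = sigma UNIV {A \<in> sets borel. uminus ` A = A}"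

lemma uminus_image_eq_iff:
  "uminus ` A = A \<longleftrightarrow> (\<forall>x. - x \<in> A \<longleftrightarrow> x \<in> A)" for A :: "'a::group_add set"
proof
  assume "uminus ` A = A"
  then show "\<forall>x. - x \<in> A \<longleftrightarrow> x \<in> A"
    by (metis image_eqI minus_minus)
next
  assume "\<forall>x. - x \<in> A \<longleftrightarrow> x \<in> A"
  then show "uminus ` A = A"
    by (force simp: image_iff)
qed

lemma space_even_borel [simp]: "space even_borel = UNIV"
  by (simp add: even_borel_def)

lemma sets_even_borel:
  "sets even_borel = {A \<in> sets borel. uminus ` A = A}"
proof -
  have "sigma_algebra (UNIV :: 'a set) {A \<in> sets borel. uminus ` A = A}"
    unfolding sigma_algebra_iff2 uminus_image_eq_iff by auto
  then show ?thesis
    unfolding even_borel_def by (simp add: sigma_algebra.sigma_sets_eq)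
qed

lemma measurable_even_borel:
  assumes "g \<in> measurable borel N" "\<And>x. g (- x) = g x"
  shows "g \<in> measurable even_borel N"
proof (rule measurableI)
  fix A assume "A \<in> sets N"
  then show "g -` A \<inter> space even_borel \<in> sets even_borel"
    using measurable_sets[OF assms(1)] assms(2)
    by (auto simp: sets_even_borel uminus_image_eq_iff)
qed (use measurable_space[OF assms(1)] in simp)

lemma measurable_borel_into_even_borel:
  assumes "h \<in> borel_measurable M"
  shows "h \<in> measurable M even_borel"
  using measurable_sets[OF assms] by (intro measurableI) (auto simp: sets_even_borel)

section \<open>Products of independent random matrices\<close>

locale matrix_walk = prob_space pS
  for pS :: "(real^'n^'n) measure" +
  assumes sets_pS: "sets pS = sets borel"
    and invertible_pS: "AE S in pS. invertible S"
begin

abbreviation walk_measure :: "nat \<Rightarrow> (nat \<Rightarrow> real^'n^'n) measure" where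
  "walk_measure t \<equiv> PiM {..<t} (\<lambda>_. pS)"

lemma space_pS: "space pS = UNIV"
  using sets_eq_imp_space_eq[OF sets_pS] by simp

lemma measurable_pS [measurable_cong]: "sets pS = sets borel"
  by (rule sets_pS)

sublocale walk: product_prob_space "\<lambda>_::nat. pS" UNIV
  by unfold_locales

lemma prob_space_walk: "prob_space (walk_measure t)"
  by (intro prob_space_PiM) unfold_locales

lemma measurable_component_pS:
  "i < t \<Longrightarrow> (\<lambda>w. w i) \<in> borel_measurable (walk_measure t)"
  by (subst measurable_cong_sets[OF refl sets_pS[symmetric]]) simp

lemma measurable_mprod_le:
  "s \<le> t \<Longrightarrow> (\<lambda>w. mprod s w) \<in> borel_measurable (walk_measure t)"
proof (induction s)
  case (Suc s)
  then have [measurable]: "(\<lambda>w. mprod s w) \<in> borel_measurable (walk_measure t)"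
    "(\<lambda>w. w s) \<in> borel_measurable (walk_measure t)"
    by (auto intro: measurable_component_pS)
  show ?case by simp
next
  case 0
  have "mprod 0 = (\<lambda>w. mat 1 :: real^'n^'n)"
    by (rule ext) simp
  then show ?case by simp
qed

lemma measurable_mprod [measurable]:
  "mprod t \<in> borel_measurable (walk_measure t)"
  using measurable_mprod_le[of t t] by simp

lemma mprod_fun_upd: "s \<le> t \<Longrightarrow> mprod s (w(t := S)) = mprod s w"
  by (induction s) auto

text \<open>The last factor has index \<open>t\<close> and is independent of the earlier ones, so
  Fubini splits it off. Both starting points are driven by the same matrices; this coupling is what
  the contraction estimate needs.\<close>

lemma nn_integral_walk_Suc:
  fixes g :: "real^'n \<Rightarrow> real^'n \<Rightarrow> ennreal"
  assumes [measurable]: "case_prod g \<in> borel_measurable (borel \<Otimes>\<^sub>M borel)"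
  shows "(\<integral>\<^sup>+w. g (pact (mprod (Suc t) w) x) (pact (mprod (Suc t) w) y) \<partial>walk_measure (Suc t)) =
    (\<integral>\<^sup>+w. \<integral>\<^sup>+S. g (pact S (pact (mprod t w) x)) (pact S (pact (mprod t w) y)) \<partial>pS \<partial>walk_measure t)"
proof -
  have "(\<lambda>w. g (pact (mprod (Suc t) w) x) (pact (mprod (Suc t) w) y))
      \<in> borel_measurable (walk_measure (Suc t))"
    by (measurable; rule measurable_mprod)
  then have "(\<lambda>w. g (pact (mprod (Suc t) w) x) (pact (mprod (Suc t) w) y))
      \<in> borel_measurable (PiM (insert t {..<t}) (\<lambda>_. pS))"
    by (simp add: lessThan_Suc)
  from walk.product_nn_integral_insert[OF _ _ this] show ?thesis
    by (simp add: lessThan_Suc mprod_fun_upd pact_matrix_mult)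
qed

end

section \<open>Stationarity for integrals and for several steps\<close>

locale stationary_walk = matrix_walk pS + mu: prob_space mu
  for pS :: "(real^'n^'n) measure" and mu :: "(real^'n) measure" +
  assumes sets_mu: "sets mu = sets sphere_space"
    and stationary_mu: "stationary pS mu"
begin

lemma space_mu: "space mu = sphere 0 1"
  using sets_eq_imp_space_eq[OF sets_mu] by (simp add: sphere_space_def space_restrict_space)

lemma measurable_ident_mu: "(\<lambda>x. x) \<in> borel_measurable mu"
proof -
  have "(\<lambda>x. x) \<in> borel_measurable (sphere_space :: (real^'n) measure)"
    unfolding sphere_space_def by (rule measurable_restrict_space1) simp
  then show ?thesis
    using measurable_cong_sets[OF sets_mu refl] by blast
qed

lemma measurable_muI: "g \<in> measurable borel N \<Longrightarrow> g \<in> measurable mu N"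
  using measurable_compose[OF measurable_ident_mu] by blast

lemma measurable_fst_mu [measurable]: "fst \<in> borel_measurable (mu \<Otimes>\<^sub>M N)"
  by (rule measurable_compose[OF measurable_fst measurable_ident_mu, simplified])

text \<open>For almost every \<open>S\<close> the image of a unit vector is again a unit vector, so
  intersecting \<open>A\<close> with the sphere does not change the inner probability.\<close>

lemma emeasure_stationary:
  assumes [measurable]: "A \<in> sets borel" and A: "uminus ` A = A"
  shows "emeasure mu (A \<inter> sphere 0 1) = (\<integral>\<^sup>+x. emeasure pS {S. pact S x \<in> A} \<partial>mu)"
proof -
  have [measurable]: "sphere (0 :: real^'n) 1 \<in> sets borel"
    by auto
  have "A \<inter> sphere 0 1 \<in> sets sphere_space"
    by (auto simp: sphere_space_def sets_restrict_space)
  moreover have "uminus ` (A \<inter> sphere 0 1) = A \<inter> sphere 0 1"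
    using A by (simp add: uminus_image_eq_iff)
  ultimately have "emeasure mu (A \<inter> sphere 0 1) =
      (\<integral>\<^sup>+x. emeasure pS {S \<in> space pS. pact S x \<in> A \<inter> sphere 0 1} \<partial>mu)"
    using stationary_mu unfolding stationary_def by blast
  also have "\<dots> = (\<integral>\<^sup>+x. emeasure pS {S. pact S x \<in> A} \<partial>mu)"
  proof (rule nn_integral_cong)
    fix x assume "x \<in> space mu"
    then have "x \<noteq> 0" by (auto simp: space_mu)
    show "emeasure pS {S \<in> space pS. pact S x \<in> A \<inter> sphere 0 1} = emeasure pS {S. pact S x \<in> A}"
    proof (rule emeasure_eq_AE)
      show "AE S in pS. S \<in> {S \<in> space pS. pact S x \<in> A \<inter> sphere 0 1} \<longleftrightarrow> S \<in> {S. pact S x \<in> A}"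
        using invertible_pS
        by eventually_elim
           (use \<open>x \<noteq> 0\<close> in \<open>simp add: space_pS norm_pact invertible_mult_vector_neq_0\<close>)
      show "{S \<in> space pS. pact S x \<in> A \<inter> sphere 0 1} \<in> sets pS"
        by measurable
      have "{S \<in> space pS. pact S x \<in> A} \<in> sets pS"
        by measurable
      then show "{S. pact S x \<in> A} \<in> sets pS"
        by (simp add: space_pS)
    qed
  qed
  finally show ?thesis .
qed

text \<open>Stationarity says that two image measures on \<open>even_borel\<close> coincide: that of
  \<open>mu\<close> under the identity and that of the product with \<open>pS\<close> under the
  action. Even Borel functions are measurable there, so their integrals agree.\<close>

lemma nn_integral_stationary:
  assumes [measurable]: "g \<in> borel_measurable borel" and g: "\<And>x. g (- x) = g x"
  shows "(\<integral>\<^sup>+x. g x \<partial>mu) = (\<integral>\<^sup>+x. \<integral>\<^sup>+S. g (pact S x) \<partial>pS \<partial>mu)"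
proof -
  have id: "(\<lambda>x. x) \<in> measurable mu even_borel"
    by (rule measurable_borel_into_even_borel[OF measurable_ident_mu])
  have m: "(\<lambda>(x, S). pact S x) \<in> borel_measurable (mu \<Otimes>\<^sub>M pS)"
    unfolding split_beta' by measurable
  note m' = measurable_borel_into_even_borel[OF m]
  have ge: "g \<in> borel_measurable even_borel"
    by (rule measurable_even_borel) (use g in auto)
  have "distr mu even_borel (\<lambda>x. x) = distr (mu \<Otimes>\<^sub>M pS) even_borel (\<lambda>(x, S). pact S x)"
  proof (rule measure_eqI)
    fix A assume "A \<in> sets (distr mu even_borel (\<lambda>x. x))"
    then have Ae: "A \<in> sets even_borel" and A[measurable]: "A \<in> sets borel" "uminus ` A = A"
      by (auto simp: sets_even_borel)
    have "emeasure (distr (mu \<Otimes>\<^sub>M pS) even_borel (\<lambda>(x, S). pact S x)) A =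
        emeasure (mu \<Otimes>\<^sub>M pS) ((\<lambda>(x, S). pact S x) -` A \<inter> space (mu \<Otimes>\<^sub>M pS))"
      by (rule emeasure_distr[OF m' Ae])
    also have "\<dots> = (\<integral>\<^sup>+x. emeasure pS (Pair x -` ((\<lambda>(x, S). pact S x) -` A \<inter> space (mu \<Otimes>\<^sub>M pS))) \<partial>mu)"
      by (rule emeasure_pair_measure_alt[OF measurable_sets[OF m A(1)]])
    also have "\<dots> = (\<integral>\<^sup>+x. emeasure pS {S. pact S x \<in> A} \<partial>mu)"
      by (intro nn_integral_cong arg_cong[where f = "emeasure pS"])
         (auto simp: space_pair_measure space_pS)
    also have "\<dots> = emeasure (distr mu even_borel (\<lambda>x. x)) A"
      by (simp add: emeasure_distr[OF id Ae] space_mu emeasure_stationary[OF A])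
    finally show "emeasure (distr mu even_borel (\<lambda>x. x)) A =
        emeasure (distr (mu \<Otimes>\<^sub>M pS) even_borel (\<lambda>(x, S). pact S x)) A" ..
  qed simp
  then have "(\<integral>\<^sup>+x. g x \<partial>distr mu even_borel (\<lambda>x. x)) =
      (\<integral>\<^sup>+x. g x \<partial>distr (mu \<Otimes>\<^sub>M pS) even_borel (\<lambda>(x, S). pact S x))"
    by simp
  then have "(\<integral>\<^sup>+x. g x \<partial>mu) = (\<integral>\<^sup>+z. g (case z of (x, S) \<Rightarrow> pact S x) \<partial>(mu \<Otimes>\<^sub>M pS))"
    by (subst (asm) nn_integral_distr[OF id], simp add: ge)
       (subst (asm) nn_integral_distr[OF m'], simp_all add: ge)
  also have "\<dots> = (\<integral>\<^sup>+x. \<integral>\<^sup>+S. g (pact S x) \<partial>pS \<partial>mu)"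
    by (subst nn_integral_fst[symmetric]) auto
  finally show ?thesis .
qed

text \<open>Averaging \<open>g\<close> over the last matrix gives another even Borel function. The
  induction hypothesis is applied to this average, hence the generalisation over \<open>g\<close>,
  and one-step stationarity finishes.\<close>

lemma nn_integral_stationary_walk:
  assumes [measurable]: "g \<in> borel_measurable borel" and g: "\<And>x. g (- x) = g x"
  shows "(\<integral>\<^sup>+x. \<integral>\<^sup>+w. g (pact (mprod t w) x) \<partial>walk_measure t \<partial>mu) = (\<integral>\<^sup>+x. g x \<partial>mu)"
  using assms
proof (induction t arbitrary: g)
  case 0
  show ?case
    using prob_space.emeasure_space_1[OF prob_space_walk[of 0]]
    by (intro nn_integral_cong) (simp add: pact_mat_1 space_mu)
next
  case (Suc t)
  note [measurable] = Suc.prems(1)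
  have "(\<integral>\<^sup>+x. \<integral>\<^sup>+w. g (pact (mprod (Suc t) w) x) \<partial>walk_measure (Suc t) \<partial>mu) =
      (\<integral>\<^sup>+x. \<integral>\<^sup>+w. \<integral>\<^sup>+S. g (pact S (pact (mprod t w) x)) \<partial>pS \<partial>walk_measure t \<partial>mu)"
    by (rule nn_integral_cong) (rule nn_integral_walk_Suc[where g = "\<lambda>x _. g x"], measurable)
  also have "\<dots> = (\<integral>\<^sup>+x. \<integral>\<^sup>+S. g (pact S x) \<partial>pS \<partial>mu)"
    by (rule Suc.IH[of "\<lambda>x. \<integral>\<^sup>+S. g (pact S x) \<partial>pS"]) (measurable, simp add: Suc.prems)
  also have "\<dots> = (\<integral>\<^sup>+x. g x \<partial>mu)"
    by (rule nn_integral_stationary[symmetric]) (use Suc.prems in auto)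
  finally show ?case .
qed

end

section \<open>Contraction on a closed invariant set\<close>

lemma integrable_proj_dist_powr:
  assumes [measurable]: "f \<in> borel_measurable M" "g \<in> borel_measurable M" and "prob_space M" "0 < l"
    and "\<And>z. norm (f z) \<le> 1" "\<And>z. norm (g z) \<le> 1"
  shows "integrable M (\<lambda>z. proj_dist (f z) (g z) powr l)"
proof -
  interpret M: prob_space M by fact
  show ?thesis
    by (rule M.integrable_const_bound[where B = 1])
       (use assms in \<open>auto intro!: always_eventually proj_dist_powr_bounds(2)\<close>)
qed

section \<open>Passing to the closure of the contracting set\<close>

context matrix_walk
begin

lemma AE_tendsto_pact:
  assumes "z \<longlonglongrightarrow> x" "norm x = 1"
  shows "AE S in pS. (\<lambda>k. pact S (z k)) \<longlonglongrightarrow> pact S x \<and> norm (pact S x) = 1"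
  using invertible_pS
proof eventually_elim
  case (elim S)
  then have "S *v x \<noteq> 0"
    using assms(2) by (intro invertible_mult_vector_neq_0) auto
  then show ?case
    using assms(1) by (auto intro: tendsto_pact norm_pact)
qed

text \<open>Along one sequence in \<open>G\<close> converging to \<open>x\<close>, only countably
  many null sets arise. Almost every \<open>S\<close> thus maps the whole sequence into
  \<open>G\<close>, and its continuity at \<open>x\<close> puts the image in the closure.\<close>

lemma closure_invariant:
  assumes "G \<subseteq> sphere 0 1" "\<And>x. x \<in> G \<Longrightarrow> AE S in pS. pact S x \<in> G" "x \<in> closure G"
  shows "AE S in pS. pact S x \<in> closure G"
proof -
  obtain z where z: "\<And>k. z k \<in> G" "z \<longlonglongrightarrow> x"
    using assms(3) closure_sequential by blast
  have "closure G \<subseteq> sphere 0 1"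
    using assms(1) by (intro closure_minimal) auto
  then have "norm x = 1"
    using assms(3) by auto
  have "AE S in pS. \<forall>k. pact S (z k) \<in> G"
    using assms(2)[OF z(1)] by (simp add: AE_all_countable)
  with AE_tendsto_pact[OF z(2) \<open>norm x = 1\<close>] show ?thesis
    by eventually_elim (auto simp: closure_sequential)
qed

text \<open>Points of the closure are approximated from \<open>G\<close>; the integrands are at most
  1, so dominated convergence preserves the inequality. The result is stated with the nonnegative
  integral, the form that is iterated along the walk.\<close>

lemma closure_contraction:
  assumes G: "G \<subseteq> sphere 0 1" and l: "0 < l"
    and contr: "\<And>x y. x \<in> G \<Longrightarrow> y \<in> G \<Longrightarrow> x \<noteq> y \<Longrightarrow> x \<noteq> - y \<Longrightarrow>
      (\<integral>S. proj_dist (pact S x) (pact S y) powr l \<partial>pS) \<le> rho * proj_dist x y powr l"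
    and "x \<in> closure G" "y \<in> closure G"
  shows "(\<integral>\<^sup>+S. proj_dist (pact S x) (pact S y) powr l \<partial>pS) \<le> ennreal (rho * proj_dist x y powr l)"
proof -
  \<comment> \<open>Approximating pairs may coincide up to sign even if their limits do not come
    from such pairs, so the inequality is first extended to \<open>x = y\<close> and
    \<open>x = - y\<close>, where both sides vanish.\<close>
  have contr': "(\<integral>S. proj_dist (pact S x) (pact S y) powr l \<partial>pS) \<le> rho * proj_dist x y powr l"
    if "x \<in> G" "y \<in> G" for x y
  proof (cases "x = y \<or> x = - y")
    case True
    have xy: "norm x = 1" "norm y = 1"
      using that G by auto
    have "AE S in pS. proj_dist (pact S x) (pact S y) powr l = 0"
      using invertible_pS
    proof eventually_elim
      case (elim S)
      then have "norm (pact S x) = 1" "norm (pact S y) = 1"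
        using xy invertible_mult_vector_neq_0[of S] norm_pact[of S]
        by (metis norm_zero zero_neq_one)+
      then show ?case
        using True proj_dist_eq_0_iff by fastforce
    qed
    then have "(\<integral>S. proj_dist (pact S x) (pact S y) powr l \<partial>pS) = 0"
      by (rule integral_eq_zero_AE)
    also have "\<dots> = rho * proj_dist x y powr l"
      using True xy proj_dist_eq_0_iff[of x y] by auto
    finally show ?thesis by simp
  qed (use contr that in auto)
  have "closure G \<subseteq> sphere 0 1"
    using G by (intro closure_minimal) auto
  then have xy: "norm x = 1" "norm y = 1"
    using assms by auto
  obtain a where a: "\<And>k. a k \<in> G" "a \<longlonglongrightarrow> x"
    using \<open>x \<in> closure G\<close> closure_sequential by blast
  obtain b where b: "\<And>k. b k \<in> G" "b \<longlonglongrightarrow> y"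
    using \<open>y \<in> closure G\<close> closure_sequential by blast
  have ab: "norm (a k) \<le> 1" "norm (b k) \<le> 1" for k
    using a(1)[of k] b(1)[of k] G by auto
  have "(\<lambda>k. \<integral>S. proj_dist (pact S (a k)) (pact S (b k)) powr l \<partial>pS) \<longlonglongrightarrow>
      (\<integral>S. proj_dist (pact S x) (pact S y) powr l \<partial>pS)"
  proof (rule integral_dominated_convergence[where w = "\<lambda>_. 1"])
    show "AE S in pS. (\<lambda>k. proj_dist (pact S (a k)) (pact S (b k)) powr l) \<longlonglongrightarrow>
        proj_dist (pact S x) (pact S y) powr l"
      using AE_tendsto_pact[OF a(2) xy(1)] AE_tendsto_pact[OF b(2) xy(2)]
      by eventually_elim (auto intro!: tendsto_proj_dist_powr norm_pact_le l)
  qed (auto intro!: proj_dist_powr_bounds norm_pact_le l)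
  moreover have "(\<lambda>k. rho * proj_dist (a k) (b k) powr l) \<longlonglongrightarrow> rho * proj_dist x y powr l"
    by (intro tendsto_mult_left tendsto_proj_dist_powr a b xy l ab)
  ultimately have "(\<integral>S. proj_dist (pact S x) (pact S y) powr l \<partial>pS) \<le> rho * proj_dist x y powr l"
    by (rule LIMSEQ_le) (use contr' a b in auto)
  moreover have "(\<integral>\<^sup>+S. proj_dist (pact S x) (pact S y) powr l \<partial>pS) =
      ennreal (\<integral>S. proj_dist (pact S x) (pact S y) powr l \<partial>pS)"
    by (intro nn_integral_eq_integral integrable_proj_dist_powr l norm_pact_le prob_space_axioms) auto
  ultimately show ?thesis
    by (simp add: ennreal_leI)
qed

end

text \<open>The set \<open>G\<close> here will be the closure of the original one, so that limits of
  images remain in it.\<close>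

locale contracting_walk = matrix_walk pS
  for pS :: "(real^'n^'n) measure" +
  fixes G :: "(real^'n) set" and rho l :: real
  assumes closed_G: "closed G" and G_sphere: "G \<subseteq> sphere 0 1"
    and G_uminus: "\<And>x. x \<in> G \<Longrightarrow> - x \<in> G"
    and invariant_G: "\<And>x. x \<in> G \<Longrightarrow> AE S in pS. pact S x \<in> G"
    and rho: "0 < rho" "rho < 1" and l_pos: "0 < l"
    and contraction: "\<And>x y. x \<in> G \<Longrightarrow> y \<in> G \<Longrightarrow>
      (\<integral>\<^sup>+S. proj_dist (pact S x) (pact S y) powr l \<partial>pS) \<le> ennreal (rho * proj_dist x y powr l)"
begin

lemma G_borel [measurable]: "G \<in> sets borel"
  using closed_G by (rule borel_closed)

text \<open>The claim is turned into the vanishing of the integral of the indicator of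
  \<open>- G\<close>, so that the last factor can be split off and one-step invariance applied at
  the random position.\<close>

lemma walk_invariant:
  assumes "x \<in> G"
  shows "AE w in walk_measure t. pact (mprod t w) x \<in> G"
proof (induction t)
  case 0
  then show ?case
    using assms G_sphere by (auto simp: pact_mat_1)
next
  case (Suc t)
  have "(\<integral>\<^sup>+w. indicator (- G) (pact (mprod (Suc t) w) x) \<partial>walk_measure (Suc t)) =
      (\<integral>\<^sup>+w. \<integral>\<^sup>+S. indicator (- G) (pact S (pact (mprod t w) x)) \<partial>pS \<partial>walk_measure t)"
    by (rule nn_integral_walk_Suc[where g = "\<lambda>x _. indicator (- G) x"]) measurable
  also have "\<dots> = (\<integral>\<^sup>+w. 0 \<partial>walk_measure t)"
  proof (rule nn_integral_cong_AE)
    show "AE w in walk_measure t.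
        (\<integral>\<^sup>+S. indicator (- G) (pact S (pact (mprod t w) x)) \<partial>pS) = 0"
      using Suc.IH
    proof eventually_elim
      case (elim w)
      have "(\<integral>\<^sup>+S. indicator (- G) (pact S (pact (mprod t w) x)) \<partial>pS) = (\<integral>\<^sup>+S. 0 \<partial>pS)"
        by (rule nn_integral_cong_AE) (use invariant_G[OF elim] in \<open>auto elim!: eventually_mono\<close>)
      then show ?case by simp
    qed
  qed
  finally have "(\<integral>\<^sup>+w. indicator (- G) (pact (mprod (Suc t) w) x) \<partial>walk_measure (Suc t)) = 0"
    by simp
  then have "AE w in walk_measure (Suc t). indicator (- G) (pact (mprod (Suc t) w) x) = (0 :: ennreal)"
    by (subst (asm) nn_integral_0_iff_AE) (auto simp del: mprod.simps)
  then show ?case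
    by eventually_elim (auto simp: indicator_def split: if_splits)
qed

text \<open>Each further matrix contributes a factor \<open>rho\<close>, because the two positions
  reached so far lie in \<open>G\<close> almost surely and one-step contraction applies to
  them.\<close>

lemma walk_contraction:
  assumes "x \<in> G" "y \<in> G"
  shows "(\<integral>\<^sup>+w. proj_dist (pact (mprod t w) x) (pact (mprod t w) y) powr l \<partial>walk_measure t)
    \<le> ennreal (rho ^ t * proj_dist x y powr l)"
proof (induction t)
  case 0
  then show ?case
    using assms G_sphere prob_space.emeasure_space_1[OF prob_space_walk[of 0]]
    by (auto simp: pact_mat_1 subset_iff)
next
  case (Suc t)
  have "(\<integral>\<^sup>+w. proj_dist (pact (mprod (Suc t) w) x) (pact (mprod (Suc t) w) y) powr l
        \<partial>walk_measure (Suc t)) =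
      (\<integral>\<^sup>+w. \<integral>\<^sup>+S. proj_dist (pact S (pact (mprod t w) x)) (pact S (pact (mprod t w) y)) powr l
        \<partial>pS \<partial>walk_measure t)"
    by (rule nn_integral_walk_Suc) measurable
  also have "\<dots> \<le> (\<integral>\<^sup>+w. ennreal rho * ennreal (proj_dist (pact (mprod t w) x) (pact (mprod t w) y) powr l)
      \<partial>walk_measure t)"
  proof (rule nn_integral_mono_AE)
    show "AE w in walk_measure t.
        (\<integral>\<^sup>+S. proj_dist (pact S (pact (mprod t w) x)) (pact S (pact (mprod t w) y)) powr l \<partial>pS)
        \<le> ennreal rho * ennreal (proj_dist (pact (mprod t w) x) (pact (mprod t w) y) powr l)"
      using walk_invariant[OF assms(1)] walk_invariant[OF assms(2)]
      by eventually_elim (use contraction rho in \<open>simp add: ennreal_mult\<close>)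
  qed
  also have "\<dots> = ennreal rho *
      (\<integral>\<^sup>+w. proj_dist (pact (mprod t w) x) (pact (mprod t w) y) powr l \<partial>walk_measure t)"
    by (rule nn_integral_cmult) measurable
  also have "\<dots> \<le> ennreal rho * ennreal (rho ^ t * proj_dist x y powr l)"
    by (rule mult_left_mono[OF Suc.IH]) simp
  also have "\<dots> = ennreal (rho ^ Suc t * proj_dist x y powr l)"
    using rho by (subst ennreal_mult[symmetric]) (auto simp: mult.assoc)
  finally show ?case .
qed

lemma integral_walk_contraction:
  assumes "x \<in> G" "y \<in> G"
  shows "integrable (walk_measure t) (\<lambda>w. proj_dist (pact (mprod t w) x) (pact (mprod t w) y) powr l)"
    and "(\<integral>w. proj_dist (pact (mprod t w) x) (pact (mprod t w) y) powr l \<partial>walk_measure t)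
      \<le> rho ^ t"
proof -
  show int: "integrable (walk_measure t)
      (\<lambda>w. proj_dist (pact (mprod t w) x) (pact (mprod t w) y) powr l)"
    by (intro integrable_proj_dist_powr prob_space_walk l_pos norm_pact_le) measurable
  have xy: "norm x \<le> 1" "norm y \<le> 1"
    using assms G_sphere by auto
  have "ennreal (\<integral>w. proj_dist (pact (mprod t w) x) (pact (mprod t w) y) powr l \<partial>walk_measure t) =
      (\<integral>\<^sup>+w. proj_dist (pact (mprod t w) x) (pact (mprod t w) y) powr l \<partial>walk_measure t)"
    by (rule nn_integral_eq_integral[symmetric, OF int]) simp
  also have "\<dots> \<le> ennreal (rho ^ t * proj_dist x y powr l)"
    by (rule walk_contraction[OF assms])
  \<comment> \<open>The initial distance is at most 1. Dropping it makes the bound uniform in the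
    starting points.\<close>
  also have "\<dots> \<le> ennreal (rho ^ t)"
    using rho proj_dist_powr_bounds[OF xy l_pos] by (intro ennreal_leI mult_left_le) auto
  finally show "(\<integral>w. proj_dist (pact (mprod t w) x) (pact (mprod t w) y) powr l \<partial>walk_measure t)
      \<le> rho ^ t"
    using rho by simp
qed

text \<open>The exceptional null set in the invariance of \<open>G\<close> depends on the point. A
  finite set \<open>B\<close> spanning the same space allows one null set for all its points, and
  linearity does the rest.\<close>

lemma span_G_invariant: "AE S in pS. (\<lambda>x. S *v x) ` span G \<subseteq> span G"
proof -
  obtain B where B: "B \<subseteq> G" "G \<subseteq> span B" "finite B"
    using maximal_independent_subset[of G] independent_imp_finite by metis
  then have span: "span B = span G"
    by (metis span_mono span_minimal subspace_span subset_antisym)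
  have "AE S in pS. \<forall>b\<in>B. pact S b \<in> G"
    using B by (intro AE_finite_allI) (auto intro: invariant_G)
  then show ?thesis
  proof eventually_elim
    case (elim S)
    have "S *v b \<in> span G" if "b \<in> B" for b
    proof -
      have "S *v b = norm (S *v b) *\<^sub>R pact S b"
        by (cases "S *v b = 0") (auto simp: pact_def)
      also have "\<dots> \<in> span G"
        using elim that by (intro span_mul span_base) auto
      finally show ?thesis .
    qed
    then have "span ((\<lambda>x. S *v x) ` B) \<subseteq> span G"
      by (intro span_minimal) auto
    then have "(\<lambda>x. S *v x) ` span B \<subseteq> span G"
      by (simp add: linear_span_image[OF matrix_vector_mul_linear])
    then show ?case by (simp add: span)
  qed
qed

end

section \<open>Stationary measures are carried by the contracting set\<close>

text \<open>A point off \<open>H\<close> lies in only finitely many \<open>E k\<close>, so the mass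
  of \<open>E k - H\<close> tends to 0 by dominated convergence. This reverse Fatou argument serves
  both limit passages below: over matrices and over hyperplanes.\<close>

lemma (in finite_measure) measure_ge_of_eventually_notin:
  assumes [measurable]: "\<And>k. E k \<in> sets M" "H \<in> sets M"
    and a: "a \<longlonglongrightarrow> c" "\<And>k. a k \<le> measure M (E k)"
    and ev: "\<And>x. x \<in> space M \<Longrightarrow> x \<notin> H \<Longrightarrow> \<forall>\<^sub>F k in sequentially. x \<notin> E k"
  shows "c \<le> measure M H"
proof -
  have "(\<lambda>k. \<integral>x. indicator (E k - H) x \<partial>M) \<longlonglongrightarrow> (\<integral>x. (0::real) \<partial>M)"
  proof (rule integral_dominated_convergence[where w = "\<lambda>_. 1"])
    show "AE x in M. (\<lambda>k. indicator (E k - H) x) \<longlonglongrightarrow> (0::real)"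
    proof (rule AE_I2)
      fix x assume "x \<in> space M"
      then have "\<forall>\<^sub>F k in sequentially. indicator (E k - H) x = (0::real)"
        by (cases "x \<in> H") (auto intro: eventually_mono[OF ev])
      then show "(\<lambda>k. indicator (E k - H) x) \<longlonglongrightarrow> (0::real)"
        by (rule tendsto_eventually)
    qed
  qed (auto simp: indicator_def)
  then have "(\<lambda>k. measure M (E k - H)) \<longlonglongrightarrow> 0"
    by simp
  then have "(\<lambda>k. measure M H + measure M (E k - H)) \<longlonglongrightarrow> measure M H + 0"
    by (intro tendsto_add tendsto_const)
  moreover have "a k \<le> measure M H + measure M (E k - H)" for k
  proof -
    have "measure M (E k) \<le> measure M (H \<union> (E k - H))"
      by (intro finite_measure_mono) auto
    also have "\<dots> \<le> measure M H + measure M (E k - H)"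
      by (intro measure_Un_le) auto
    finally show ?thesis using a(2)[of k] by linarith
  qed
  ultimately show ?thesis
    using LIMSEQ_le[OF a(1)] by fastforce
qed

text \<open>The normalised matrices have a limit \<open>L\<close> of norm 1 by compactness. The
  images of the spanning set merge, so the range of \<open>L\<close> is a line through a point
  \<open>u\<close> of \<open>G\<close>. Whenever \<open>L *v x\<close> is nonzero, the images of
  \<open>x\<close> thus approach \<open>u\<close> or \<open>- u\<close>, both in
  \<open>G\<close>.\<close>

lemma rank_one_limit:
  fixes M :: "nat \<Rightarrow> real^'n^'n"
  assumes G: "closed G" "G \<subseteq> sphere 0 1" "\<And>x. x \<in> G \<Longrightarrow> - x \<in> G"
    and B: "span B = UNIV"
    and MG: "\<And>k b. b \<in> B \<Longrightarrow> pact (M k) b \<in> G"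
    and close: "\<And>b b'. b \<in> B \<Longrightarrow> b' \<in> B \<Longrightarrow>
      (\<lambda>k. proj_dist (pact (M k) b) (pact (M k) b')) \<longlonglongrightarrow> 0"
  obtains v :: "real^'n" and r where "norm v = 1" "strict_mono r"
    "\<And>x. x \<bullet> v \<noteq> 0 \<Longrightarrow> (\<lambda>k. infdist (pact (M (r k)) x) G) \<longlonglongrightarrow> 0"
proof -
  have "\<not> B \<subseteq> {0}"
  proof
    assume "B \<subseteq> {0}"
    then have "span B \<subseteq> span {0}"
      by (rule span_mono)
    then have "axis undefined 1 = (0 :: real^'n)"
      using B by auto
    then show False
      by (metis axis_eq_0_iff zero_neq_one)
  qed
  then obtain b1 where b1: "b1 \<in> B"
    by auto
  have M_nz: "M k \<noteq> 0" for k
    using MG[OF b1, of k] G(2) by (auto simp: norm_pact_eq_1_iff subset_iff)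
  define N where "N k = M k /\<^sub>R norm (M k)" for k
  have pact_N: "pact (N k) x = pact (M k) x" for k x
    unfolding N_def by (rule pact_scaleR) (use M_nz in simp)
  have "\<forall>k. N k \<in> sphere 0 1"
    using M_nz by (simp add: N_def)
  then obtain L r where L: "L \<in> sphere 0 1" "strict_mono r" "(N \<circ> r) \<longlonglongrightarrow> L"
    using compact_imp_seq_compact[OF compact_sphere] unfolding seq_compact_def by metis
  have pact_lim: "(\<lambda>k. pact (M (r k)) x) \<longlonglongrightarrow> pact L x" if "L *v x \<noteq> 0" for x
    using tendsto_pact[OF L(3) tendsto_const that] by (simp add: pact_N)
  have "L \<noteq> 0"
    using L(1) by auto
  obtain b0 where b0: "b0 \<in> B" "L *v b0 \<noteq> 0"
  proof (rule ccontr)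
    assume "\<not> thesis"
    then have "B \<subseteq> {x. L *v x = 0}"
      using that by auto
    moreover have "subspace {x. L *v x = 0}"
      by (rule linear_subspace_kernel[OF matrix_vector_mul_linear])
    ultimately have "span B \<subseteq> {x. L *v x = 0}"
      by (rule span_minimal)
    then have "\<forall>x. L *v x = 0"
      using B by auto
    then show False
      using \<open>L \<noteq> 0\<close> by (simp add: matrix_eq)
  qed
  define u where "u = pact L b0"
  have u: "norm u = 1" "u \<in> G"
    using norm_pact[OF b0(2)] closed_sequentially[OF G(1) _ pact_lim[OF b0(2)]] MG[OF b0(1)]
    by (auto simp: u_def)
  have "L *v b \<in> span {u}" if "b \<in> B" for b
  proof (cases "L *v b = 0")
    case False
    have "(\<lambda>k. proj_dist (pact (M (r k)) b) (pact (M (r k)) b0)) \<longlonglongrightarrow> proj_dist (pact L b) u"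
      unfolding u_def by (intro tendsto_proj_dist pact_lim False b0)
    moreover have "(\<lambda>k. proj_dist (pact (M (r k)) b) (pact (M (r k)) b0)) \<longlonglongrightarrow> 0"
      using LIMSEQ_subseq_LIMSEQ[OF close[OF that b0(1)] L(2)] by (simp add: o_def)
    ultimately have "proj_dist (pact L b) u = 0"
      by (rule LIMSEQ_unique)
    then have "pact L b = u \<or> pact L b = - u"
      using u norm_pact[OF False] by (simp add: proj_dist_eq_0_iff)
    then have "pact L b \<in> span {u}"
      by (auto intro: span_base span_neg[OF span_base])
    moreover have "L *v b = norm (L *v b) *\<^sub>R pact L b"
      using False by (simp add: pact_def)
    ultimately show ?thesis
      by (metis span_mul)
  qed (simp add: span_zero)
  then have "span ((\<lambda>x. L *v x) ` B) \<subseteq> span {u}"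
    by (intro span_minimal) auto
  then have range_L: "L *v x \<in> span {u}" for x
    using B by (auto simp: linear_span_image[OF matrix_vector_mul_linear])
  have conv: "(\<lambda>k. infdist (pact (M (r k)) x) G) \<longlonglongrightarrow> 0" if "L *v x \<noteq> 0" for x
  proof -
    obtain c where c: "L *v x = c *\<^sub>R u"
      using range_L[of x] by (auto simp: span_singleton)
    with that have "c \<noteq> 0" by auto
    then have "pact L x = sgn c *\<^sub>R u"
      using u(1) by (simp add: pact_def c sgn_real_def)
    then have "pact L x \<in> G"
      using u(2) G(3) \<open>c \<noteq> 0\<close> by (simp add: sgn_real_def)
    then show ?thesis
      using tendsto_infdist[OF pact_lim[OF that], of G] by simp
  qed
  \<comment> \<open>A nonzero row of \<open>L\<close> serves as normal vector: if \<open>x\<close>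
    is not orthogonal to it, a coordinate of \<open>L *v x\<close> is nonzero.\<close>
  obtain i where i: "L $ i \<noteq> 0"
    using \<open>L \<noteq> 0\<close> by (metis vec_eq_iff zero_index)
  show thesis
  proof
    show "norm (L $ i /\<^sub>R norm (L $ i)) = 1"
      using i by simp
    fix x assume "x \<bullet> (L $ i /\<^sub>R norm (L $ i)) \<noteq> 0"
    then have "(L *v x) $ i \<noteq> 0"
      by (simp add: matrix_vector_mul_component inner_commute)
    then show "(\<lambda>k. infdist (pact (M (r k)) x) G) \<longlonglongrightarrow> 0"
      by (intro conv) auto
  qed (rule L(2))
qed

section \<open>Mass outside the contracting set\<close>

locale stationary_contracting_walk =
  contracting_walk pS G rho l + stationary_walk pS mu
  for pS :: "(real^'n^'n) measure" and G rho l and mu :: "(real^'n) measure" +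
  assumes irreducible: "\<And>V. subspace V \<Longrightarrow> V \<noteq> {0} \<Longrightarrow> V \<noteq> UNIV \<Longrightarrow>
      \<not> (AE S in pS. (\<lambda>x. S *v x) ` V \<subseteq> V)"
    and G_nonempty: "G \<noteq> {}"
begin

lemma sphere_borel [measurable]: "sphere (0 :: real^'n) 1 \<in> sets borel"
  by auto

lemma sets_muI: "A \<in> sets borel \<Longrightarrow> A \<subseteq> sphere 0 1 \<Longrightarrow> A \<in> sets mu"
  by (auto simp: sets_mu sphere_space_def sets_restrict_space)

lemma span_G: "span G = UNIV"
proof (rule ccontr)
  assume "span G \<noteq> UNIV"
  obtain x where x: "x \<in> G"
    using G_nonempty by blast
  then have "x \<noteq> 0"
    using G_sphere by auto
  then have "span G \<noteq> {0}"
    using span_base[OF x] by auto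
  with irreducible[OF subspace_span] \<open>span G \<noteq> UNIV\<close> span_G_invariant show False
    by blast
qed

text \<open>Points of \<open>G\<close> stay in \<open>G\<close> almost surely and never enter
  \<open>A\<close>, so by stationarity all the mass of \<open>A\<close> arrives from outside
  \<open>G\<close>. The general random matrix \<open>Phi\<close> covers both the product of
  \<open>t\<close> factors and a single step.\<close>

lemma exterior_mass:
  fixes Phi :: "'b \<Rightarrow> real^'n^'n"
  assumes "prob_space Q" and [measurable]: "Phi \<in> borel_measurable Q"
    and stat: "\<And>g. g \<in> borel_measurable borel \<Longrightarrow> (\<And>x. g (- x) = g x) \<Longrightarrow>
      (\<integral>\<^sup>+x. \<integral>\<^sup>+w. g (pact (Phi w) x) \<partial>Q \<partial>mu) = (\<integral>\<^sup>+x. g x \<partial>mu)"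
    and inv: "\<And>x. x \<in> G \<Longrightarrow> AE w in Q. pact (Phi w) x \<in> G"
    and A [measurable]: "A \<in> sets borel" and A': "A \<subseteq> sphere 0 1 - G" "uminus ` A = A"
  shows "integrable Q (\<lambda>w. measure mu {x \<in> sphere 0 1 - G. pact (Phi w) x \<in> A})"
    and "(\<integral>w. measure mu {x \<in> sphere 0 1 - G. pact (Phi w) x \<in> A} \<partial>Q) = measure mu A"
proof -
  interpret Q: prob_space Q by fact
  interpret mQ: pair_sigma_finite mu Q ..
  have [measurable]: "snd \<in> borel_measurable (Q \<Otimes>\<^sub>M mu)"
    using measurable_compose[OF measurable_snd measurable_ident_mu, of Q] by simp
  let ?h = "\<lambda>w. \<integral>\<^sup>+x. indicator (- G) x * indicator A (pact (Phi w) x) \<partial>mu"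
  have em: "emeasure mu {x \<in> sphere 0 1 - G. pact (Phi w) x \<in> A} = ?h w" for w
  proof -
    have "{x \<in> sphere 0 1 - G. pact (Phi w) x \<in> A} \<in> sets mu"
      by (rule sets_muI) auto
    then have "emeasure mu {x \<in> sphere 0 1 - G. pact (Phi w) x \<in> A} =
        (\<integral>\<^sup>+x. indicator {x \<in> sphere 0 1 - G. pact (Phi w) x \<in> A} x \<partial>mu)"
      by simp
    also have "\<dots> = ?h w"
      by (rule nn_integral_cong) (auto simp: indicator_def space_mu)
    finally show ?thesis .
  qed
  have h [measurable]: "?h \<in> borel_measurable Q"
    by measurable
  have "(\<lambda>w. measure mu {x \<in> sphere 0 1 - G. pact (Phi w) x \<in> A}) = (\<lambda>w. enn2real (?h w))"
    unfolding measure_def em ..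
  then have m: "(\<lambda>w. measure mu {x \<in> sphere 0 1 - G. pact (Phi w) x \<in> A}) \<in> borel_measurable Q"
    by simp
  show int: "integrable Q (\<lambda>w. measure mu {x \<in> sphere 0 1 - G. pact (Phi w) x \<in> A})"
    by (rule Q.integrable_const_bound[where B = 1]) (use m in auto)
  have "ennreal (\<integral>w. measure mu {x \<in> sphere 0 1 - G. pact (Phi w) x \<in> A} \<partial>Q) =
      (\<integral>\<^sup>+w. measure mu {x \<in> sphere 0 1 - G. pact (Phi w) x \<in> A} \<partial>Q)"
    by (rule nn_integral_eq_integral[symmetric, OF int]) simp
  also have "\<dots> = (\<integral>\<^sup>+w. ?h w \<partial>Q)"
    by (simp only: em flip: mu.emeasure_eq_measure)
  also have "\<dots> = (\<integral>\<^sup>+x. \<integral>\<^sup>+w. indicator (- G) x * indicator A (pact (Phi w) x) \<partial>Q \<partial>mu)"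
    by (rule mQ.Fubini') measurable
  also have "\<dots> = (\<integral>\<^sup>+x. \<integral>\<^sup>+w. indicator A (pact (Phi w) x) \<partial>Q \<partial>mu)"
  proof (rule nn_integral_cong)
    fix x
    show "(\<integral>\<^sup>+w. indicator (- G) x * indicator A (pact (Phi w) x) \<partial>Q) =
        (\<integral>\<^sup>+w. indicator A (pact (Phi w) x) \<partial>Q)"
    proof (cases "x \<in> G")
      case True
      show ?thesis
        by (rule nn_integral_cong_AE)
           (use inv[OF True] A' in \<open>auto elim!: eventually_mono simp: indicator_def\<close>)
    qed simp
  qed
  also have "\<dots> = (\<integral>\<^sup>+x. indicator A x \<partial>mu)"
    by (rule stat) (use A'(2) in \<open>auto simp: uminus_image_eq_iff indicator_def\<close>)
  also have "\<dots> = emeasure mu A"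
    using A' by (intro nn_integral_indicator sets_muI A) auto
  finally show "(\<integral>w. measure mu {x \<in> sphere 0 1 - G. pact (Phi w) x \<in> A} \<partial>Q) = measure mu A"
    by (simp add: mu.emeasure_eq_measure)
qed

text \<open>First-moment argument over products of a fixed large length \<open>t\<close>: the
  exterior mass sent into \<open>A\<close> has mean \<open>measure mu A\<close>, while distances
  within the finite set \<open>B\<close> have small mean. If no matrix were good, integrating a
  pointwise bound would contradict the first fact.\<close>

lemma exists_contracting_matrix:
  assumes B: "finite B" "B \<subseteq> G"
    and A: "A \<in> sets borel" "A \<subseteq> sphere 0 1 - G" "uminus ` A = A"
    and "0 < \<delta>" "0 < \<eta>"
  obtains M where "\<And>b. b \<in> B \<Longrightarrow> pact M b \<in> G"
    "\<And>b b'. b \<in> B \<Longrightarrow> b' \<in> B \<Longrightarrow> proj_dist (pact M b) (pact M b') < \<eta>"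
    "measure mu A - \<delta> \<le> measure mu {x \<in> sphere 0 1 - G. pact M x \<in> A}"
proof (rule ccontr)
  note M = that
  assume "\<not> thesis"
  have "(\<lambda>t. (1 + \<delta>) * (real (card (B \<times> B)) / \<eta> powr l) * rho ^ t) \<longlonglongrightarrow>
      (1 + \<delta>) * (real (card (B \<times> B)) / \<eta> powr l) * 0"
    using rho by (intro tendsto_mult_left LIMSEQ_power_zero) auto
  then have "\<forall>\<^sub>F t in sequentially. (1 + \<delta>) * (real (card (B \<times> B)) / \<eta> powr l) * rho ^ t < \<delta>"
    by (rule order_tendstoD(2)) (use \<open>0 < \<delta>\<close> in simp)
  then obtain t where t: "(1 + \<delta>) * (real (card (B \<times> B)) / \<eta> powr l) * rho ^ t < \<delta>"
    by (auto simp: eventually_sequentially)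
  interpret W: prob_space "walk_measure t"
    by (rule prob_space_walk)
  let ?d = "\<lambda>w b b'. proj_dist (pact (mprod t w) b) (pact (mprod t w) b')"
  let ?h = "\<lambda>w. measure mu {x \<in> sphere 0 1 - G. pact (mprod t w) x \<in> A}"
  \<comment> \<open>A Markov-type penalty: it is at least 1 as soon as some pair has distance at
    least \<open>\<eta>\<close>. Its weight \<open>1 + \<delta>\<close> then lifts the bound below
    to at least 1, above any value of \<open>?h\<close>; \<open>t\<close> was chosen so that the
    weighted mean stays below \<open>\<delta>\<close>.\<close>
  let ?s = "\<lambda>w. (\<Sum>(b, b')\<in>B \<times> B. ?d w b b' powr l / \<eta> powr l)"
  have int_h: "integrable (walk_measure t) ?h" and h: "(\<integral>w. ?h w \<partial>walk_measure t) = measure mu A"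
    by (rule exterior_mass[OF prob_space_walk measurable_mprod nn_integral_stationary_walk walk_invariant A];
        assumption)+
  have int_d: "integrable (walk_measure t) (\<lambda>w. ?d w b b' powr l / \<eta> powr l)"
    if "b \<in> B" "b' \<in> B" for b b'
    using that B by (intro integrable_divide integral_walk_contraction) auto
  have int_s: "integrable (walk_measure t) ?s"
    using int_d by (intro Bochner_Integration.integrable_sum) auto
  have sum_int: "(\<integral>w. ?s w \<partial>walk_measure t) =
      (\<Sum>(b, b')\<in>B \<times> B. \<integral>w. ?d w b b' powr l / \<eta> powr l \<partial>walk_measure t)"
    using int_d by (subst Bochner_Integration.integral_sum) (auto simp: split_beta')
  have "AE w in walk_measure t. \<forall>b\<in>B. pact (mprod t w) b \<in> G"
    using B by (intro AE_finite_allI walk_invariant) auto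
  then have "AE w in walk_measure t. ?h w \<le> measure mu A - \<delta> + (1 + \<delta>) * ?s w"
  proof eventually_elim
    case (elim w)
    show ?case
    proof (cases "\<forall>b\<in>B. \<forall>b'\<in>B. ?d w b b' < \<eta>")
      case True
      then have "?h w < measure mu A - \<delta>"
        using elim M[of "mprod t w"] \<open>\<not> thesis\<close> by force
      moreover have "0 \<le> (1 + \<delta>) * ?s w"
        using \<open>0 < \<delta>\<close> by (intro mult_nonneg_nonneg sum_nonneg) auto
      ultimately show ?thesis by linarith
    next
      case False
      then obtain b b' where b: "b \<in> B" "b' \<in> B" "\<eta> \<le> ?d w b b'"
        by (auto simp: not_less)
      have "1 \<le> ?d w b b' powr l / \<eta> powr l"
        using b(3) \<open>0 < \<eta>\<close> l_pos by (simp add: powr_mono2)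
      also have "\<dots> \<le> ?s w"
        using member_le_sum[of "(b, b')" "B \<times> B" "\<lambda>(b, b'). ?d w b b' powr l / \<eta> powr l"] b B
        by auto
      finally have "1 \<le> ?s w" .
      then have "1 + \<delta> \<le> (1 + \<delta>) * ?s w"
        using \<open>0 < \<delta>\<close> by simp
      moreover have "?h w \<le> 1" "0 \<le> measure mu A"
        by simp_all
      ultimately show ?thesis by linarith
    qed
  qed
  then have "(\<integral>w. ?h w \<partial>walk_measure t) \<le> (\<integral>w. measure mu A - \<delta> + (1 + \<delta>) * ?s w \<partial>walk_measure t)"
    using int_s by (intro integral_mono_AE int_h) auto
  also have "\<dots> = measure mu A - \<delta> + (1 + \<delta>) * (\<Sum>(b, b')\<in>B \<times> B. \<integral>w. ?d w b b' powr l / \<eta> powr l \<partial>walk_measure t)"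
    using int_s W.prob_space by (simp add: sum_int)
  also have "(1 + \<delta>) * (\<Sum>(b, b')\<in>B \<times> B. \<integral>w. ?d w b b' powr l / \<eta> powr l \<partial>walk_measure t)
      \<le> (1 + \<delta>) * (\<Sum>(b, b')\<in>B \<times> B. rho ^ t / \<eta> powr l)"
    using B \<open>0 < \<delta>\<close> by (intro mult_left_mono sum_mono) (auto intro!: divide_right_mono integral_walk_contraction)
  also have "\<dots> = (1 + \<delta>) * (real (card (B \<times> B)) / \<eta> powr l) * rho ^ t"
    by (simp add: split_beta')
  finally show False
    using h t by simp
qed

end

lemma infdist_uminus:
  fixes G :: "'a::real_normed_vector set"
  assumes "\<And>x. x \<in> G \<Longrightarrow> - x \<in> G"
  shows "infdist (- x) G = infdist x G"
proof -
  have "uminus ` G = G"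
    unfolding uminus_image_eq_iff using assms by (metis minus_minus)
  then have "(INF a\<in>G. dist (- x) a) = (INF a\<in>uminus ` G. dist (- x) a)"
    by simp
  also have "\<dots> = (INF a\<in>G. dist x a)"
    by (simp add: image_image dist_minus)
  finally show ?thesis
    by (simp add: infdist_def)
qed

section \<open>Hyperplanes carrying the exterior mass\<close>

context stationary_contracting_walk
begin

lemma infdist_G_ge_borel [measurable]: "{x \<in> sphere 0 1. e \<le> infdist x G} \<in> sets borel"
proof -
  have "closed (sphere 0 1 \<inter> {x. e \<le> infdist x G})"
    by (intro closed_Int closed_Collect_le continuous_intros) auto
  then show ?thesis
    by (simp add: borel_closed Int_def)
qed

text \<open>Contracting matrices with both tolerances \<open>1 / (k + 1)\<close> feed
  \<open>rank_one_limit\<close>. Off \<open>G\<close> and off the resulting hyperplane, images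
  eventually come within \<open>e\<close> of \<open>G\<close> and so miss \<open>A\<close>; hence
  the mass sent into \<open>A\<close> concentrates on the hyperplane.\<close>

lemma hyperplane_mass_ge:
  assumes "0 < e"
  obtains v where "norm v = 1"
    "measure mu {x \<in> sphere 0 1. e \<le> infdist x G} \<le> measure mu {x \<in> sphere 0 1 - G. x \<bullet> v = 0}"
proof -
  define A where "A = {x \<in> sphere 0 1. e \<le> infdist x G}"
  have A [measurable]: "A \<in> sets borel" "A \<subseteq> sphere 0 1 - G" "uminus ` A = A"
    using \<open>0 < e\<close> infdist_uminus[OF G_uminus] infdist_G_ge_borel
    by (auto simp: A_def uminus_image_eq_iff)
  obtain B where B: "B \<subseteq> G" "G \<subseteq> span B" "finite B"
    using maximal_independent_subset[of G] independent_imp_finite by metis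
  have "span G \<subseteq> span B"
    using B(2) by (rule span_minimal) simp
  then have "span B = UNIV"
    using span_G by auto
  define good where "good k M \<longleftrightarrow> (\<forall>b\<in>B. pact M b \<in> G) \<and>
      (\<forall>b\<in>B. \<forall>b'\<in>B. proj_dist (pact M b) (pact M b') < inverse (real (Suc k))) \<and>
      measure mu A - inverse (real (Suc k)) \<le> measure mu {x \<in> sphere 0 1 - G. pact M x \<in> A}"
    for k M
  have "\<exists>M. good k M" for k
    by (rule exists_contracting_matrix[OF B(3,1) A, of "inverse (real (Suc k))" "inverse (real (Suc k))"])
       (auto simp: good_def)
  then obtain M' where "\<forall>k. good k (M' k)"
    using choice by metis
  then obtain M where M: "\<And>k b. b \<in> B \<Longrightarrow> pact (M k) b \<in> G"
      "\<And>k b b'. b \<in> B \<Longrightarrow> b' \<in> B \<Longrightarrow>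
        proj_dist (pact (M k) b) (pact (M k) b') < inverse (real (Suc k))"
      "\<And>k. measure mu A - inverse (real (Suc k)) \<le>
        measure mu {x \<in> sphere 0 1 - G. pact (M k) x \<in> A}"
    unfolding good_def by blast
  have close: "(\<lambda>k. proj_dist (pact (M k) b) (pact (M k) b')) \<longlonglongrightarrow> 0" if "b \<in> B" "b' \<in> B" for b b'
  proof (rule Lim_null_comparison[OF _ LIMSEQ_inverse_real_of_nat])
    show "\<forall>\<^sub>F k in sequentially.
        norm (proj_dist (pact (M k) b) (pact (M k) b')) \<le> inverse (real (Suc k))"
    proof (rule always_eventually, rule allI)
      fix k
      show "norm (proj_dist (pact (M k) b) (pact (M k) b')) \<le> inverse (real (Suc k))"
        using M(2)[OF that, of k] proj_dist_bounds(1)[OF norm_pact_le[of "M k" b] norm_pact_le[of "M k" b']]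
        by simp
    qed
  qed
  from rank_one_limit[OF closed_G G_sphere G_uminus \<open>span B = UNIV\<close> M(1) close]
  obtain v r where v: "norm v = 1" "strict_mono r"
    "\<And>x. x \<bullet> v \<noteq> 0 \<Longrightarrow> (\<lambda>k. infdist (pact (M (r k)) x) G) \<longlonglongrightarrow> 0"
    by blast
  have "measure mu A \<le> measure mu {x \<in> sphere 0 1 - G. x \<bullet> v = 0}"
  proof (rule mu.measure_ge_of_eventually_notin)
    show "{x \<in> sphere 0 1 - G. pact (M (r k)) x \<in> A} \<in> sets mu" for k
      by (intro sets_muI) auto
    show "{x \<in> sphere 0 1 - G. x \<bullet> v = 0} \<in> sets mu"
      by (intro sets_muI) auto
    show "(\<lambda>k. measure mu A - inverse (real (Suc (r k)))) \<longlonglongrightarrow> measure mu A"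
      using tendsto_diff[OF tendsto_const LIMSEQ_subseq_LIMSEQ[OF LIMSEQ_inverse_real_of_nat v(2)],
          of "measure mu A"]
      by (simp add: o_def)
    show "measure mu A - inverse (real (Suc (r k))) \<le>
        measure mu {x \<in> sphere 0 1 - G. pact (M (r k)) x \<in> A}" for k
      by (rule M(3))
    fix x assume x: "x \<in> space mu" "x \<notin> {x \<in> sphere 0 1 - G. x \<bullet> v = 0}"
    show "\<forall>\<^sub>F k in sequentially. x \<notin> {x \<in> sphere 0 1 - G. pact (M (r k)) x \<in> A}"
    proof (cases "x \<in> G")
      case False
      with x have "x \<bullet> v \<noteq> 0"
        by (auto simp: space_mu)
      from order_tendstoD(2)[OF v(3)[OF this] \<open>0 < e\<close>] show ?thesis
        by eventually_elim (auto simp: A_def)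
    qed simp
  qed
  with v(1) that show thesis
    unfolding A_def by blast
qed

text \<open>The hyperplane found for distance at least \<open>1 / (k + 1)\<close> depends on
  \<open>k\<close>. Compactness gives a limit \<open>u\<close> of the unit normals, and a point not
  orthogonal to \<open>u\<close> is eventually not orthogonal to the approximating normals.\<close>

lemma exists_full_mass_hyperplane:
  obtains v where "norm v = 1" "AE x in mu. x \<notin> G \<longrightarrow> x \<bullet> v = 0"
proof -
  let ?A = "\<lambda>k. {x \<in> sphere 0 1. inverse (real (Suc k)) \<le> infdist x G}"
  let ?H = "\<lambda>v. {x \<in> sphere 0 1 - G. x \<bullet> v = 0}"
  have "\<forall>k. \<exists>v. norm v = 1 \<and> measure mu (?A k) \<le> measure mu (?H v)"
  proof
    fix k
    have "0 < inverse (real (Suc k))"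
      by simp
    then show "\<exists>v. norm v = 1 \<and> measure mu (?A k) \<le> measure mu (?H v)"
      by (rule hyperplane_mass_ge) blast
  qed
  from choice[OF this]
  obtain v where v: "\<And>k. norm (v k) = 1" "\<And>k. measure mu (?A k) \<le> measure mu (?H (v k))"
    by blast
  have "\<forall>k. v k \<in> sphere 0 1"
    using v(1) by simp
  then obtain u r where u: "u \<in> sphere 0 1" "strict_mono r" "(v \<circ> r) \<longlonglongrightarrow> u"
    using compact_imp_seq_compact[OF compact_sphere] unfolding seq_compact_def by metis
  have H_sets: "?H w \<in> sets mu" for w
    by (intro sets_muI) auto
  have "(\<lambda>k. measure mu (?A k)) \<longlonglongrightarrow> measure mu (\<Union>k. ?A k)"
  proof (rule mu.finite_Lim_measure_incseq)
    show "range ?A \<subseteq> sets mu"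
      using infdist_G_ge_borel by (intro image_subsetI sets_muI) auto
    show "incseq ?A"
      by (auto simp: incseq_def intro: order_trans[rotated])
  qed
  \<comment> \<open>Closedness of \<open>G\<close> enters here: every point outside has positive
    distance.\<close>
  also have "(\<Union>k. ?A k) = sphere 0 1 - G"
  proof -
    have "(\<exists>k. inverse (real (Suc k)) \<le> infdist x G) \<longleftrightarrow> x \<notin> G" for x
    proof -
      have "x \<notin> G \<longleftrightarrow> 0 < infdist x G"
        using in_closed_iff_infdist_zero[OF closed_G G_nonempty, of x] infdist_nonneg[of x G]
        by linarith
      also have "\<dots> \<longleftrightarrow> (\<exists>k. inverse (real (Suc k)) \<le> infdist x G)"
        using reals_Archimedean[of "infdist x G"]
        by (metis inverse_positive_iff_positive less_eq_real_def of_nat_0_less_iff order_less_le_trans zero_less_Suc)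
      finally show ?thesis ..
    qed
    then show ?thesis by blast
  qed
  finally have lim: "(\<lambda>k. measure mu (?A k)) \<longlonglongrightarrow> measure mu (sphere 0 1 - G)" .
  have "measure mu (sphere 0 1 - G) \<le> measure mu (?H u)"
  proof (rule mu.measure_ge_of_eventually_notin)
    show "(\<lambda>k. measure mu (?A (r k))) \<longlonglongrightarrow> measure mu (sphere 0 1 - G)"
      using LIMSEQ_subseq_LIMSEQ[OF lim u(2)] by (simp add: o_def)
    show "measure mu (?A (r k)) \<le> measure mu (?H (v (r k)))" for k
      by (rule v(2))
    fix x assume x: "x \<in> space mu" "x \<notin> ?H u"
    show "\<forall>\<^sub>F k in sequentially. x \<notin> ?H (v (r k))"
    proof (cases "x \<in> G")
      case False
      with x have "x \<bullet> u \<noteq> 0"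
        by (auto simp: space_mu)
      moreover have "(\<lambda>k. x \<bullet> v (r k)) \<longlonglongrightarrow> x \<bullet> u"
        using tendsto_inner[OF tendsto_const u(3)] by (simp add: o_def)
      ultimately have "\<forall>\<^sub>F k in sequentially. x \<bullet> v (r k) \<noteq> 0"
        by (rule tendsto_imp_eventually_ne[rotated])
      then show ?thesis
        by eventually_elim auto
    qed simp
  qed (rule H_sets)+
  moreover have B: "sphere 0 1 - G \<in> sets mu"
    by (rule sets_muI) auto
  ultimately have "measure mu ((sphere 0 1 - G) - ?H u) = 0"
    using mu.finite_measure_Diff[OF B H_sets[of u]] measure_nonneg[of mu "(sphere 0 1 - G) - ?H u"]
    by (simp add: Collect_mono_iff subset_iff)
  moreover have "(sphere 0 1 - G) - ?H u \<in> sets mu"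
    using B H_sets by blast
  ultimately have "AE x in mu. x \<notin> (sphere 0 1 - G) - ?H u"
    by (intro AE_not_in) (simp add: null_sets_def mu.emeasure_eq_measure)
  moreover have "AE x in mu. x \<in> sphere 0 1"
    using AE_space[of mu] by (simp add: space_mu)
  ultimately have "AE x in mu. x \<notin> G \<longrightarrow> x \<bullet> u = 0"
    by eventually_elim auto
  with u(1) that show thesis by auto
qed

text \<open>Take a subspace \<open>V\<close> of least dimension carrying \<open>mu\<close> off
  \<open>G\<close>. For almost every \<open>S\<close>, the vectors of \<open>V\<close> that
  \<open>S\<close> maps into \<open>V\<close> form another such subspace, so minimality gives
  invariance of \<open>V\<close>. Irreducibility leaves only \<open>{0}\<close>, which contains no
  unit vector.\<close>

lemma AE_stationary_in_G: "AE x in mu. x \<in> G"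
proof -
  let ?full = "\<lambda>V. subspace V \<and> (AE x in mu. x \<notin> G \<longrightarrow> x \<in> V)"
  obtain v where v: "norm v = 1" "AE x in mu. x \<notin> G \<longrightarrow> x \<bullet> v = 0"
    by (rule exists_full_mass_hyperplane)
  let ?H = "{x. x \<bullet> v = 0}"
  have H: "?full ?H"
    using v(2) subspace_hyperplane[of v] by (simp add: inner_commute)
  obtain V where V: "?full V" and V_min: "\<And>W. ?full W \<Longrightarrow> dim V \<le> dim W"
    using ex_has_least_nat[of ?full ?H dim] H by blast
  have "dim ?H < DIM(real^'n)"
  proof -
    have "v \<noteq> 0"
      using v(1) by auto
    then show ?thesis
      using dim_hyperplane[of v] by (simp add: inner_commute)
  qed
  \<comment> \<open>The hyperplane competes in the minimisation, which rules out the full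
    space.\<close>
  then have "V \<noteq> UNIV"
    using V_min[OF H] by auto
  have V_borel [measurable]: "V \<in> sets borel"
    by (rule borel_closed[OF closed_subspace[OF conjunct1[OF V]]])
  have sphere_AE: "AE x in mu. x \<in> sphere 0 1"
    using AE_space[of mu] by (simp add: space_mu)
  let ?B = "sphere 0 1 - G"
  let ?A = "V \<inter> ?B"
  let ?h = "\<lambda>S. measure mu {x \<in> ?B. pact S x \<in> ?A}"
  have B: "?B \<in> sets mu" and A: "?A \<in> sets mu"
    by (auto intro!: sets_muI)
  have "measure mu ?A = measure mu ?B"
    by (rule mu.finite_measure_eq_AE[OF _ A B]) (use V in \<open>auto elim: eventually_mono\<close>)
  have A_sym: "uminus ` ?A = ?A"
    using V subspace_neg[of V] G_uminus
    by (auto simp: uminus_image_eq_iff) (metis minus_minus)+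
  have id: "(\<lambda>S. S) \<in> borel_measurable pS"
    by measurable
  have int_h: "integrable pS ?h" and h: "(\<integral>S. ?h S \<partial>pS) = measure mu ?A"
    by (rule exterior_mass[OF prob_space_axioms id nn_integral_stationary[symmetric] invariant_G _ _ A_sym];
        auto)+
  have E_sets: "{x \<in> ?B. pact S x \<in> ?A} \<in> sets mu" for S
    by (rule sets_muI) auto
  have h_le: "?h S \<le> measure mu ?B" for S
    by (rule mu.finite_measure_mono[OF _ B]) auto
  \<comment> \<open>The mean of \<open>?h\<close> is the mass of \<open>?A\<close>, equal to that of
    \<open>?B\<close> by the choice of \<open>V\<close>, and \<open>?h\<close> never exceeds it. So
    the nonnegative defect vanishes almost surely.\<close>
  have "(\<integral>S. measure mu ?B - ?h S \<partial>pS) = 0"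
    using int_h h \<open>measure mu ?A = measure mu ?B\<close> prob_space by simp
  then have "AE S in pS. measure mu ?B - ?h S = 0"
    by (subst (asm) integral_nonneg_eq_0_iff_AE) (use int_h h_le in auto)
  then have "AE S in pS. (\<lambda>x. S *v x) ` V \<subseteq> V"
  proof eventually_elim
    case (elim S)
    let ?W = "V \<inter> {x. S *v x \<in> V}"
    have "measure mu (?B - {x \<in> ?B. pact S x \<in> ?A}) = 0"
      using elim by (subst mu.finite_measure_Diff[OF B E_sets]) auto
    then have "AE x in mu. x \<notin> ?B - {x \<in> ?B. pact S x \<in> ?A}"
      using B E_sets by (intro AE_not_in) (auto simp: null_sets_def mu.emeasure_eq_measure)
    then have "AE x in mu. x \<notin> G \<longrightarrow> x \<in> ?W"
      using conjunct2[OF V] sphere_AE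
    proof eventually_elim
      case (elim x)
      show ?case
      proof
        assume "x \<notin> G"
        with elim have "x \<in> V" "pact S x \<in> V"
          by auto
        moreover have "S *v x = norm (S *v x) *\<^sub>R pact S x"
          by (cases "S *v x = 0") (auto simp: pact_def)
        ultimately show "x \<in> ?W"
          using V by (metis (no_types, lifting) IntI mem_Collect_eq subspace_scale)
      qed
    qed
    moreover have "subspace ?W"
      using V linear_subspace_vimage[OF matrix_vector_mul_linear[of S], of V]
      by (auto intro: subspace_inter simp: vimage_def)
    ultimately have "dim V \<le> dim ?W"
      by (intro V_min) auto
    then have "?W = V"
      using subspace_dim_equal[OF \<open>subspace ?W\<close>] V by auto
    then show ?case by auto
  qed
  then have "V = {0}"
    using irreducible V \<open>V \<noteq> UNIV\<close> by blast
  from conjunct2[OF V] sphere_AE show ?thesis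
    by eventually_elim (auto simp: \<open>V = {0}\<close>)
qed

end

section \<open>Geometric convergence\<close>

lemma (in prob_space) abs_integral_le_const:
  fixes h :: "'a \<Rightarrow> real"
  assumes "integrable M h" "AE x in M. \<bar>h x\<bar> \<le> c"
  shows "\<bar>\<integral>x. h x \<partial>M\<bar> \<le> c"
proof -
  have "\<bar>\<integral>x. h x \<partial>M\<bar> \<le> (\<integral>x. \<bar>h x\<bar> \<partial>M)"
    by (rule integral_abs_bound)
  also have "\<dots> \<le> (\<integral>x. c \<partial>M)"
    by (rule integral_mono_AE) (use assms in auto)
  finally show ?thesis
    by (simp add: prob_space)
qed

context stationary_walk
begin

text \<open>Adding the bound \<open>K\<close> makes \<open>g\<close> nonnegative, so the identity
  for nonnegative integrals applies; the constant then cancels because all measures involved are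
  probabilities.\<close>

lemma integral_stationary_walk:
  fixes g :: "real^'n \<Rightarrow> real"
  assumes [measurable]: "g \<in> borel_measurable borel" and g: "\<And>x. g (- x) = g x"
    and K: "\<And>x. \<bar>g x\<bar> \<le> K"
  shows "integrable mu (\<lambda>x. \<integral>w. g (pact (mprod t w) x) \<partial>walk_measure t)"
    and "(\<integral>x. \<integral>w. g (pact (mprod t w) x) \<partial>walk_measure t \<partial>mu) = (\<integral>x. g x \<partial>mu)"
proof -
  interpret W: prob_space "walk_measure t"
    by (rule prob_space_walk)
  have nonneg: "0 \<le> g x + K" for x
    using K[of x] by linarith
  have int_w: "integrable (walk_measure t) (\<lambda>w. g (pact (mprod t w) x))" for x
    by (rule W.integrable_const_bound[where B = K]) (use K in auto)
  have int_g: "integrable mu g"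
    by (rule mu.integrable_const_bound[where B = K]) (use K in \<open>auto intro: measurable_muI\<close>)
  have "(\<lambda>x. \<integral>w. g (pact (mprod t w) x) \<partial>walk_measure t) \<in> borel_measurable mu"
    by (rule measurable_muI) measurable
  then show int: "integrable mu (\<lambda>x. \<integral>w. g (pact (mprod t w) x) \<partial>walk_measure t)"
    by (rule mu.integrable_const_bound[where B = K, rotated])
       (use K in \<open>auto intro!: always_eventually W.abs_integral_le_const int_w\<close>)
  have eq: "(\<integral>\<^sup>+w. ennreal (g (pact (mprod t w) x) + K) \<partial>walk_measure t) =
      ennreal ((\<integral>w. g (pact (mprod t w) x) \<partial>walk_measure t) + K)" for x
    using int_w[of x] nonneg W.prob_space by (subst nn_integral_eq_integral) auto
  have nonneg': "0 \<le> (\<integral>w. g (pact (mprod t w) x) \<partial>walk_measure t) + K" for x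
    using W.abs_integral_le_const[OF int_w[of x], of K] K by force
  have "ennreal ((\<integral>x. \<integral>w. g (pact (mprod t w) x) \<partial>walk_measure t \<partial>mu) + K) =
      (\<integral>\<^sup>+x. ennreal ((\<integral>w. g (pact (mprod t w) x) \<partial>walk_measure t) + K) \<partial>mu)"
    using int nonneg' mu.prob_space by (subst nn_integral_eq_integral) auto
  also have "\<dots> = (\<integral>\<^sup>+x. \<integral>\<^sup>+w. ennreal (g (pact (mprod t w) x) + K) \<partial>walk_measure t \<partial>mu)"
    by (simp add: eq)
  also have "\<dots> = (\<integral>\<^sup>+x. ennreal (g x + K) \<partial>mu)"
    by (rule nn_integral_stationary_walk) (use g in auto)
  also have "\<dots> = ennreal ((\<integral>x. g x \<partial>mu) + K)"
    using int_g nonneg mu.prob_space by (subst nn_integral_eq_integral) auto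
  finally have "ennreal ((\<integral>x. \<integral>w. g (pact (mprod t w) x) \<partial>walk_measure t \<partial>mu) + K) =
      ennreal ((\<integral>x. g x \<partial>mu) + K)" .
  moreover have "0 \<le> (\<integral>x. g x \<partial>mu) + K"
    using mu.abs_integral_le_const[OF int_g, of K] K by force
  moreover have "0 \<le> (\<integral>x. \<integral>w. g (pact (mprod t w) x) \<partial>walk_measure t \<partial>mu) + K"
  proof -
    have "\<bar>\<integral>w. g (pact (mprod t w) x) \<partial>walk_measure t\<bar> \<le> K" for x
      using W.abs_integral_le_const[OF int_w[of x], of K] K by blast
    then show ?thesis
      using mu.abs_integral_le_const[OF int, of K] by force
  qed
  ultimately show "(\<integral>x. \<integral>w. g (pact (mprod t w) x) \<partial>walk_measure t \<partial>mu) = (\<integral>x. g x \<partial>mu)"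
    by simp
qed

end

context stationary_contracting_walk
begin

text \<open>By stationarity the integral of \<open>f\<close> is also the \<open>mu\<close>-average
  of its \<open>t\<close>-step expectations. Since \<open>mu\<close> is carried by \<open>G\<close>,
  it suffices to compare the expectations from \<open>x0\<close> and from another point of
  \<open>G\<close> under the same matrices.\<close>

lemma holder_convergence:
  fixes f :: "real^'n \<Rightarrow> real"
  assumes x0: "x0 \<in> G" and f: "proj_fun f" "is_holder l f"
  shows "\<bar>(\<integral>w. f (pact (mprod t w) x0) \<partial>walk_measure t) - (\<integral>x. f x \<partial>mu)\<bar>
    \<le> rho ^ t * holder_coeff l f"
proof -
  interpret W: prob_space "walk_measure t"
    by (rule prob_space_walk)
  let ?C = "holder_coeff l f"
  have C: "0 \<le> ?C"
    by (rule holder_coeff_nonneg[OF f(2)])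
  \<comment> \<open>\<open>f\<close> is only controlled on the sphere, and \<open>pact S x\<close> takes the junk value 0 when \<open>S x = 0\<close>.\<close>
  define g where "g x = (if x \<in> sphere 0 1 then f x else f 0)" for x
  have g_borel [measurable]: "g \<in> borel_measurable borel"
    unfolding g_def
    by (intro borel_measurable_continuous_on_if holder_imp_continuous_on_sphere[OF f l_pos]) auto
  have g_even: "g (- x) = g x" for x
    using f(1) by (simp add: g_def proj_fun_def)
  have g_pact: "g (pact S x) = f (pact S x)" for S x
    by (cases "S *v x = 0") (auto simp: g_def norm_pact, simp add: pact_def)
  have g_holder: "\<bar>g x - g y\<bar> \<le> ?C * proj_dist x y powr l" if "norm x = 1" "norm y = 1" for x y
    using holder_coeff_bound[OF f that] that by (simp add: g_def)
  have nx0: "norm x0 = 1"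
    using x0 G_sphere by auto
  \<comment> \<open>Off the sphere \<open>g\<close> is the constant \<open>f 0\<close>; on it,
    \<open>g\<close> differs from \<open>g x0\<close> by at most the Hoelder coefficient, since
    distances are at most 1.\<close>
  have K: "\<bar>g x\<bar> \<le> \<bar>f 0\<bar> + \<bar>g x0\<bar> + ?C" for x
  proof (cases "norm x = 1")
    case True
    have "\<bar>g x - g x0\<bar> \<le> ?C * proj_dist x x0 powr l"
      by (rule g_holder[OF True nx0])
    also have "\<dots> \<le> ?C"
      using True nx0 l_pos C by (intro mult_left_le proj_dist_powr_bounds) auto
    finally show ?thesis by linarith
  qed (use C in \<open>simp add: g_def\<close>)
  have int_w: "integrable (walk_measure t) (\<lambda>w. g (pact (mprod t w) x))" for x
    by (rule W.integrable_const_bound[where B = "\<bar>f 0\<bar> + \<bar>g x0\<bar> + ?C"]) (use K in auto)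
  let ?E = "\<lambda>x. \<integral>w. g (pact (mprod t w) x) \<partial>walk_measure t"
  have int_E: "integrable mu ?E" and E: "(\<integral>x. ?E x \<partial>mu) = (\<integral>x. g x \<partial>mu)"
    by (rule integral_stationary_walk[OF g_borel g_even K])+
  have E_diff: "\<bar>?E x0 - ?E x\<bar> \<le> rho ^ t * ?C" if "x \<in> G" for x
  proof -
    let ?d = "\<lambda>w. proj_dist (pact (mprod t w) x0) (pact (mprod t w) x) powr l"
    have "\<bar>?E x0 - ?E x\<bar> = \<bar>\<integral>w. g (pact (mprod t w) x0) - g (pact (mprod t w) x) \<partial>walk_measure t\<bar>"
      using int_w by simp
    also have "\<dots> \<le> (\<integral>w. \<bar>g (pact (mprod t w) x0) - g (pact (mprod t w) x)\<bar> \<partial>walk_measure t)"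
      by (rule integral_abs_bound)
    also have "\<dots> \<le> (\<integral>w. ?C * ?d w \<partial>walk_measure t)"
    proof (rule integral_mono_AE)
      show "AE w in walk_measure t. \<bar>g (pact (mprod t w) x0) - g (pact (mprod t w) x)\<bar> \<le> ?C * ?d w"
        using walk_invariant[OF x0, of t] walk_invariant[OF that, of t]
        by eventually_elim (use G_sphere in \<open>auto intro!: g_holder\<close>)
    qed (use int_w integral_walk_contraction(1)[OF x0 that] in auto)
    also have "\<dots> = ?C * (\<integral>w. ?d w \<partial>walk_measure t)"
      by simp
    also have "\<dots> \<le> ?C * rho ^ t"
      by (rule mult_left_mono[OF integral_walk_contraction(2)[OF x0 that] C])
    finally show ?thesis
      by (simp add: mult.commute)
  qed
  have "\<bar>\<integral>x. ?E x0 - ?E x \<partial>mu\<bar> \<le> rho ^ t * ?C"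
  proof (rule mu.abs_integral_le_const)
    show "AE x in mu. \<bar>?E x0 - ?E x\<bar> \<le> rho ^ t * ?C"
      using AE_stationary_in_G by eventually_elim (rule E_diff)
  qed (use int_E in auto)
  moreover have "(\<integral>x. ?E x0 - ?E x \<partial>mu) = ?E x0 - (\<integral>x. g x \<partial>mu)"
    using int_E E mu.prob_space by simp
  moreover have "(\<integral>x. g x \<partial>mu) = (\<integral>x. f x \<partial>mu)"
    by (rule Bochner_Integration.integral_cong) (auto simp: g_def space_mu)
  ultimately show ?thesis
    by (simp add: g_pact)
qed

end

text \<open>The position at time \<open>t\<close> depends on the first \<open>t\<close> matrices
  alone, so its expectation is an integral over their finite product. Invariance and contraction are
  transferred to \<open>closure G\<close>, where the limit arguments are available.\<close>

theorem theoremA3: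
  fixes pS :: "(real^'n^'n) measure"
    and G :: "(real^'n) set"
    and mu :: "(real^'n) measure"
    and rho l :: real
    and x0 :: "real^'n"
    and f :: "real^'n \<Rightarrow> real"
  assumes pS_prob: "prob_space pS" and pS_sets: "sets pS = sets borel"
    and pS_inv: "AE S in pS. invertible S"
    and L1: "\<And>V. subspace V \<Longrightarrow> V \<noteq> {0} \<Longrightarrow> V \<noteq> UNIV \<Longrightarrow>
               \<not> (AE S in pS. (\<lambda>x. S *v x) ` V \<subseteq> V)"
    and L2: "\<exists>M. (\<forall>i. M i \<in> msupport pS) \<and>
               (\<lambda>T. sing_val 2 (mprod T M) / sing_val 1 (mprod T M)) \<longlonglongrightarrow> 0"
    and G_meas: "G \<in> sets borel" and G_sphere: "G \<subseteq> sphere 0 1"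
    and G_sym: "uminus ` G = G"
    and A1: "\<And>x. x \<in> G \<Longrightarrow> AE S in pS. pact S x \<in> G"
    and rho: "0 < rho" "rho < 1" and l_pos: "0 < l"
    and A2': "\<And>x y. x \<in> G \<Longrightarrow> y \<in> G \<Longrightarrow> x \<noteq> y \<Longrightarrow> x \<noteq> -y \<Longrightarrow>
               (\<integral>S. proj_dist (pact S x) (pact S y) powr l \<partial>pS) \<le> rho * proj_dist x y powr l"
    and mu_prob: "prob_space mu" and mu_sets: "sets mu = sets sphere_space"
    and mu_stat: "stationary pS mu"
    and x0: "x0 \<in> G"
    and f_proj: "proj_fun f" and f_holder: "is_holder l f"
  shows "\<bar>(\<integral>w. f (pact (mprod t w) x0) \<partial>(PiM {..<t} (\<lambda>_. pS))) - (\<integral>x. f x \<partial>mu)\<bar>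
           \<le> rho ^ t * holder_coeff l f"
proof -
  interpret pS: prob_space pS by fact
  interpret mu: prob_space mu by fact
  interpret matrix_walk pS
    by unfold_locales (fact pS_sets pS_inv)+
  have "closure G \<subseteq> sphere 0 1"
    using G_sphere by (intro closure_minimal) auto
  moreover have "- x \<in> closure G" if "x \<in> closure G" for x
  proof -
    have "uminus ` closure G \<subseteq> closure (uminus ` G)"
      by (intro closure_bounded_linear_image_subset bounded_linear_minus bounded_linear_ident)
    then show ?thesis
      using that G_sym by auto
  qed
  ultimately interpret stationary_contracting_walk pS "closure G" rho l mu
    using closure_invariant[OF G_sphere A1] closure_contraction[OF G_sphere l_pos A2']
      L1 rho l_pos mu_sets mu_stat x0 closure_subset[of G]
    by unfold_locales auto
  show ?thesis
    using x0 closure_subset[of G] by (intro holder_convergence f_proj f_holder) auto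
qed

end
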